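(* Let $0<\alpha_1\le\alpha_2\le\dots\le\alpha_n\le1$ and $\boldsymbol\alpha=(\alpha_1,\dots,\alpha_n)$. A function $f:\mathcal{S}_2^n\to\mathbf{R}\cup\{\infty\}$ is $\boldsymbol\alpha$-bisubmodular if and only if $f$ is submodular on the modular semilattice $\mathcal{S}_2^n$ with respect to the valuation $v_{\boldsymbol\alpha}$.
   Context: $\mathcal{S}_2=\{-,0,+\}$ with minimum $0$ and incomparable $-,+$; $\mathcal{S}_2^n$ has the componentwise order. Operations on $\mathcal{S}_2$, extended componentwise: $x\wedge y=x$ if $x=y$, else $0$; $x\sqcup y$ is the larger of $x,y$ if comparable and $0$ if $\{x,y\}=\{-,+\}$; $x\sqcup_+y=+$ if $\{x,y\}=\{-,+\}$ and $x\sqcup y$ otherwise. For $i=0,\dots,n$, $\sqcup^i$ applies $\sqcup_+$ in the first $i$ coordinates and $\sqcup$ in the others. With $\alpha_0:=0$, $\alpha_{n+1}:=1$, $f$ is $\boldsymbol\alpha$-bisubmodular if $f(p)+f(q)\ge f(p\wedge q)+\sum_{i=0}^n(\alpha_{i+1}-\alpha_i)f(p\sqcup^iq)$ for all $p,q$. Valuation: $v_i(0)=0$, $v_i(+)=1$, $v_i(-)=\alpha_i$, and $v_{\boldsymbol\alpha}(x)=\sum_iv_i(x_i)$. Submodularity w.r.t. $v=v_{\boldsymbol\alpha}$: for $p,q$ let $I(p,q)$ be the elements on shortest $p$–$q$ paths of the covering graph of $\mathcal{S}_2^n$; $v(u;p,q)=(v(u\wedge p)-v(p\wedge q),v(u\wedge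 q)-v(p\wedge q))$; $\mathcal{E}(p,q)$ the $u\in I(p,q)$ with $v(u;p,q)$ a componentwise-maximal extreme point of the convex hull $\mathrm{Conv}I(p,q)$ of these vectors; $C(u;p,q)=\{w\in\mathbf{R}^2_{\ge0}:\langle w,v(u;p,q)\rangle=\max_{z\in\mathrm{Conv}I(p,q)}\langle w,z\rangle\}=\{(x,y)\ge0:y\cos\alpha\le x\sin\alpha,\ y\cos\beta\ge x\sin\beta\}$ ($0\le\beta\le\alpha\le\pi/2$), $[C]=\frac{\sin\alpha}{\sin\alpha+\cos\alpha}-\frac{\sin\beta}{\sin\beta+\cos\beta}$. $f$ is submodular w.r.t. $v$ if $f(p)+f(q)\ge f(p\wedge q)+\sum_{u\in\mathcal{E}(p,q)}[C(u;p,q)]f(u)$ for all $p,q$ (zero-coefficient terms omitted; $a+\infty=\infty$). *)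

theory Defs
  imports "HOL-Analysis.Analysis"
begin

datatype s2 = Neg | Zer | Pos

definition s2_le :: "s2 \<Rightarrow> s2 \<Rightarrow> bool" where
  "s2_le x y \<longleftrightarrow> x = y \<or> x = Zer"

definition s2_meet :: "s2 \<Rightarrow> s2 \<Rightarrow> s2" where
  "s2_meet x y = (if x = y then x else Zer)"

definition s2_join :: "s2 \<Rightarrow> s2 \<Rightarrow> s2" where
  "s2_join x y = (if s2_le x y then y else if s2_le y x then x else Zer)"

definition s2_join_plus :: "s2 \<Rightarrow> s2 \<Rightarrow> s2" where
  "s2_join_plus x y = (if {x, y} = {Neg, Pos} then Pos else s2_join x y)"

definition S2n :: "nat \<Rightarrow> (nat \<Rightarrow> s2) set" where
  "S2n n = {p. \<forall>i. i \<notin> {1..n} \<longrightarrow> p i = Zer}"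

definition vmeet :: "(nat \<Rightarrow> s2) \<Rightarrow> (nat \<Rightarrow> s2) \<Rightarrow> (nat \<Rightarrow> s2)" where
  "vmeet p q = (\<lambda>i. s2_meet (p i) (q i))"

definition vjoin_i :: "nat \<Rightarrow> (nat \<Rightarrow> s2) \<Rightarrow> (nat \<Rightarrow> s2) \<Rightarrow> (nat \<Rightarrow> s2)" where
  "vjoin_i k p q = (\<lambda>i. if i \<le> k then s2_join_plus (p i) (q i) else s2_join (p i) (q i))"

definition alpha_ext :: "nat \<Rightarrow> (nat \<Rightarrow> real) \<Rightarrow> nat \<Rightarrow> real" where
  "alpha_ext n \<alpha> i = (if i = 0 then 0 else if i = n + 1 then 1 else \<alpha> i)"

definition alpha_bisubmodular :: "nat \<Rightarrow> (nat \<Rightarrow> real) \<Rightarrow> ((nat \<Rightarrow> s2) \<Rightarrow> ereal) \<Rightarrow> bool" where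
  "alpha_bisubmodular n \<alpha> f \<longleftrightarrow>
     (\<forall>p\<in>S2n n. \<forall>q\<in>S2n n.
        f p + f q \<ge> f (vmeet p q) +
          (\<Sum>i\<in>{0..n}. ereal (alpha_ext n \<alpha> (i + 1) - alpha_ext n \<alpha> i) * f (vjoin_i i p q)))"

definition vcoord :: "(nat \<Rightarrow> real) \<Rightarrow> nat \<Rightarrow> s2 \<Rightarrow> real" where
  "vcoord \<alpha> i x = (case x of Zer \<Rightarrow> 0 | Pos \<Rightarrow> 1 | Neg \<Rightarrow> \<alpha> i)"

definition val :: "nat \<Rightarrow> (nat \<Rightarrow> real) \<Rightarrow> (nat \<Rightarrow> s2) \<Rightarrow> real" where
  "val n \<alpha> p = (\<Sum>i\<in>{1..n}. vcoord \<alpha> i (p i))"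

definition vec_le :: "(nat \<Rightarrow> s2) \<Rightarrow> (nat \<Rightarrow> s2) \<Rightarrow> bool" where
  "vec_le p q \<longleftrightarrow> (\<forall>i. s2_le (p i) (q i))"

definition vec_lt :: "(nat \<Rightarrow> s2) \<Rightarrow> (nat \<Rightarrow> s2) \<Rightarrow> bool" where
  "vec_lt p q \<longleftrightarrow> vec_le p q \<and> p \<noteq> q"

definition covers :: "nat \<Rightarrow> (nat \<Rightarrow> s2) \<Rightarrow> (nat \<Rightarrow> s2) \<Rightarrow> bool" where
  "covers n p q \<longleftrightarrow> p \<in> S2n n \<and> q \<in> S2n n \<and> vec_lt p q \<and>
     \<not> (\<exists>r\<in>S2n n. vec_lt p r \<and> vec_lt r q)"

definition adj :: "nat \<Rightarrow> (nat \<Rightarrow> s2) \<Rightarrow> (nat \<Rightarrow> s2) \<Rightarrow> bool" where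
  "adj n p q \<longleftrightarrow> covers n p q \<or> covers n q p"

definition is_walk :: "nat \<Rightarrow> (nat \<Rightarrow> s2) list \<Rightarrow> bool" where
  "is_walk n xs \<longleftrightarrow> xs \<noteq> [] \<and> set xs \<subseteq> S2n n \<and>
     (\<forall>k. Suc k < length xs \<longrightarrow> adj n (xs ! k) (xs ! Suc k))"

definition gdist :: "nat \<Rightarrow> (nat \<Rightarrow> s2) \<Rightarrow> (nat \<Rightarrow> s2) \<Rightarrow> nat" where
  "gdist n p q = (LEAST k. \<exists>xs. is_walk n xs \<and> hd xs = p \<and> last xs = q \<and> length xs = Suc k)"

definition interval :: "nat \<Rightarrow> (nat \<Rightarrow> s2) \<Rightarrow> (nat \<Rightarrow> s2) \<Rightarrow> (nat \<Rightarrow> s2) set" where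
  "interval n p q = {u. \<exists>xs. is_walk n xs \<and> hd xs = p \<and> last xs = q \<and>
       length xs = Suc (gdist n p q) \<and> u \<in> set xs}"

definition vpt :: "nat \<Rightarrow> (nat \<Rightarrow> real) \<Rightarrow> (nat \<Rightarrow> s2) \<Rightarrow> (nat \<Rightarrow> s2) \<Rightarrow> (nat \<Rightarrow> s2) \<Rightarrow> real \<times> real" where
  "vpt n \<alpha> p q u = (val n \<alpha> (vmeet u p) - val n \<alpha> (vmeet p q),
                     val n \<alpha> (vmeet u q) - val n \<alpha> (vmeet p q))"

definition convI :: "nat \<Rightarrow> (nat \<Rightarrow> real) \<Rightarrow> (nat \<Rightarrow> s2) \<Rightarrow> (nat \<Rightarrow> s2) \<Rightarrow> (real \<times> real) set" where
  "convI n \<alpha> p q = convex hull (vpt n \<alpha> p q ` interval n p q)"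

definition cw_maximal :: "(real \<times> real) set \<Rightarrow> real \<times> real \<Rightarrow> bool" where
  "cw_maximal S x \<longleftrightarrow> x \<in> S \<and> \<not> (\<exists>z\<in>S. fst x \<le> fst z \<and> snd x \<le> snd z \<and> z \<noteq> x)"

definition Ecal :: "nat \<Rightarrow> (nat \<Rightarrow> real) \<Rightarrow> (nat \<Rightarrow> s2) \<Rightarrow> (nat \<Rightarrow> s2) \<Rightarrow> (nat \<Rightarrow> s2) set" where
  "Ecal n \<alpha> p q = {u \<in> interval n p q.
      vpt n \<alpha> p q u extreme_point_of convI n \<alpha> p q \<and> cw_maximal (convI n \<alpha> p q) (vpt n \<alpha> p q u)}"

definition Ccone :: "nat \<Rightarrow> (nat \<Rightarrow> real) \<Rightarrow> (nat \<Rightarrow> s2) \<Rightarrow> (nat \<Rightarrow> s2) \<Rightarrow> (nat \<Rightarrow> s2) \<Rightarrow> (real \<times> real) set" where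
  "Ccone n \<alpha> p q u = {w. fst w \<ge> 0 \<and> snd w \<ge> 0 \<and>
      (\<forall>z\<in>convI n \<alpha> p q. fst w * fst z + snd w * snd z \<le>
          fst w * fst (vpt n \<alpha> p q u) + snd w * snd (vpt n \<alpha> p q u))}"

definition cone_measure :: "(real \<times> real) set \<Rightarrow> real" where
  "cone_measure C = (let (a, b) = (SOME (a, b). 0 \<le> b \<and> b \<le> a \<and> a \<le> pi / 2 \<and>
        C = {(x, y). x \<ge> 0 \<and> y \<ge> 0 \<and> y * cos a \<le> x * sin a \<and> y * cos b \<ge> x * sin b})
     in sin a / (sin a + cos a) - sin b / (sin b + cos b))"

definition submodular_wrt_val :: "nat \<Rightarrow> (nat \<Rightarrow> real) \<Rightarrow> ((nat \<Rightarrow> s2) \<Rightarrow> ereal) \<Rightarrow> bool" where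
  "submodular_wrt_val n \<alpha> f \<longleftrightarrow>
     (\<forall>p\<in>S2n n. \<forall>q\<in>S2n n.
        f p + f q \<ge> f (vmeet p q) +
          (\<Sum>u\<in>Ecal n \<alpha> p q. ereal (cone_measure (Ccone n \<alpha> p q u)) * f u))"

end

theory Submission
  imports Defs
begin

text \<open>
  Normalise a weight to \<open>w = (1 - \<tau>, \<tau>)\<close>. On a coordinate where \<open>p\<close> and \<open>q\<close> conflict, the
  maximiser of \<open>w\<close> over \<open>I(p,q)\<close> picks \<open>p\<^sub>i\<close> below a threshold of \<open>\<tau>\<close> and \<open>q\<^sub>i\<close> above it; so
  \<open>\<E>(p,q)\<close> is a chain of mixtures of \<open>p\<close> and \<open>q\<close>, and \<open>[C(u;p,q)]\<close> is the length of the
  \<open>\<tau>\<close>-interval on which \<open>u\<close> is selected. These vertices carry \<open>-\<close> where \<open>p \<squnion>\<^sup>i q\<close> carries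
  \<open>0\<close>, so the two inequalities differ for given \<open>p\<close> and \<open>q\<close>. Both conditions are instead
  equivalent to a local one: the effective domain is closed under meets and mixtures, \<open>f\<close> is
  submodular on bounded pairs, and \<open>f(p \<and> q) \<le> (1 - c) f(p) + c f(q)\<close> whenever all
  differing coordinates conflict with the same threshold \<open>c\<close>. The general inequalities follow by
  summing the local ones along the chain of mixtures.
\<close>

text \<open>The inequality with threshold c is what both sides say in their simplest case. Let p and
  q differ only at conflicts, where p has + and \<alpha> has one value a, so c = 1/(1+a). The
  valuation side has the vertices p and q with coefficients c and 1 - c, so f(p) + f(q) bounds f(p
  \<and> q) + c f(p) + (1-c) f(q). On the other side \<open>vjoin_i k p q\<close> is p \<and> q with
  total coefficient a and p with total coefficient 1 - a, so f(p) + f(q) bounds (1+a) f(p \<and> q)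
  + (1-a) f(p). Solved for f(p \<and> q), the two agree.

  Infinite values are a further obstacle. Real inequalities can be added only inside the domain, and
  each side puts only its own points there: mixtures on one side, the \<open>vjoin_i k p q\<close>
  with positive coefficient on the other. Each family therefore has to be generated from the
  operations that the other side provides.\<close>

definition s2_conflict :: "s2 \<Rightarrow> s2 \<Rightarrow> bool" where
  "s2_conflict x y \<longleftrightarrow> x \<noteq> y \<and> x \<noteq> Zer \<and> y \<noteq> Zer"

definition vjoin :: "(nat \<Rightarrow> s2) \<Rightarrow> (nat \<Rightarrow> s2) \<Rightarrow> nat \<Rightarrow> s2" where
  "vjoin p q = (\<lambda>i. s2_join (p i) (q i))"

text \<open>With \<open>v(s)\<close> and \<open>v(-s)\<close> the values of the two conflicting signs, \<open>s\<close> is preferred at the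
  weight \<open>(1 - \<tau>, \<tau>)\<close> iff \<open>(1 - \<tau>) v(s) > \<tau> v(-s)\<close>, that is \<open>\<tau> < v(s) / (v(s) + v(-s))\<close>.\<close>
definition thr :: "real \<Rightarrow> s2 \<Rightarrow> real" where
  "thr a s = (if s = Pos then 1 / (1 + a) else a / (1 + a))"

text \<open>A tie at the threshold goes to \<open>q\<close>, so \<open>mix\<close> is constant on
  intervals closed on the left, and the left endpoint can name the vertex.\<close>

definition mix :: "(nat \<Rightarrow> real) \<Rightarrow> real \<Rightarrow> (nat \<Rightarrow> s2) \<Rightarrow> (nat \<Rightarrow> s2) \<Rightarrow> nat \<Rightarrow> s2" where
  "mix \<alpha> \<tau> p q = (\<lambda>i. if s2_conflict (p i) (q i)
     then (if \<tau> < thr (\<alpha> i) (p i) then p i else q i) else s2_join (p i) (q i))"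

lemmas s2_defs = s2_conflict_def s2_meet_def s2_join_def s2_join_plus_def s2_le_def

lemma s2_tables:
  "s2_meet x x = x" "s2_meet Zer x = Zer" "s2_meet x Zer = Zer"
  "s2_meet Neg Pos = Zer" "s2_meet Pos Neg = Zer"
  "s2_join x x = x" "s2_join Zer x = x" "s2_join x Zer = x"
  "s2_join Neg Pos = Zer" "s2_join Pos Neg = Zer"
  "s2_join_plus x x = x" "s2_join_plus Zer x = x" "s2_join_plus x Zer = x"
  "s2_join_plus Neg Pos = Pos" "s2_join_plus Pos Neg = Pos"
  "\<not> s2_conflict x x" "\<not> s2_conflict Zer x" "\<not> s2_conflict x Zer"
  "s2_conflict Neg Pos" "s2_conflict Pos Neg"
  by (cases x; auto simp: s2_defs)+

lemma S2nD: "p \<in> S2n n \<Longrightarrow> i \<notin> {1..n} \<Longrightarrow> p i = Zer"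
  by (auto simp: S2n_def)

lemma s2_conflict_index:
  assumes "p \<in> S2n n" "s2_conflict (p i) y"
  shows "i \<in> {1..n}"
  using assms S2nD[of p n i] unfolding s2_conflict_def by blast

lemma vmeet_S2n [intro]: "p \<in> S2n n \<Longrightarrow> q \<in> S2n n \<Longrightarrow> vmeet p q \<in> S2n n"
  by (auto simp: S2n_def vmeet_def s2_defs)

lemma vjoin_i_S2n [intro]: "p \<in> S2n n \<Longrightarrow> q \<in> S2n n \<Longrightarrow> vjoin_i k p q \<in> S2n n"
  by (auto simp: S2n_def vjoin_i_def s2_defs)

lemma mix_S2n [intro]: "p \<in> S2n n \<Longrightarrow> q \<in> S2n n \<Longrightarrow> mix \<alpha> \<tau> p q \<in> S2n n"
  by (auto simp: S2n_def mix_def s2_defs)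

section \<open>Shortest paths in the covering graph\<close>

text \<open>The covering graph of one factor is the path \<open>Neg\<close>, \<open>Zer\<close>,
  \<open>Pos\<close>, and this is its path metric. A covering step in the product changes one
  coordinate, so distances add up over coordinates.\<close>

definition s2_dist :: "s2 \<Rightarrow> s2 \<Rightarrow> nat" where
  "s2_dist x y = (if x = y then 0 else if s2_conflict x y then 2 else 1)"

definition vdist :: "nat \<Rightarrow> (nat \<Rightarrow> s2) \<Rightarrow> (nat \<Rightarrow> s2) \<Rightarrow> nat" where
  "vdist n p q = (\<Sum>i\<in>{1..n}. s2_dist (p i) (q i))"

lemma s2_dist_triangle: "s2_dist x z \<le> s2_dist x y + s2_dist y z"
  by (cases x; cases y; cases z) (auto simp: s2_dist_def s2_defs)

lemma s2_dist_between:
  "s2_dist x u + s2_dist u y = s2_dist x y \<longleftrightarrow> s2_conflict x y \<or> u = x \<or> u = y"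
  by (cases x; cases y; cases u) (auto simp: s2_dist_def s2_defs)

lemma vdist_self [simp]: "vdist n p p = 0"
  by (simp add: vdist_def s2_dist_def)

lemma vdist_triangle: "vdist n p r \<le> vdist n p q + vdist n q r"
  unfolding vdist_def sum.distrib[symmetric] by (intro sum_mono s2_dist_triangle)

text \<open>The triangle inequality holds in each coordinate, so the sum is tight only if every
  coordinate is; for the same reason the truncated subtraction in the proof is exact.\<close>

lemma vdist_between:
  "vdist n p u + vdist n u q = vdist n p q \<longleftrightarrow>
     (\<forall>i\<in>{1..n}. s2_conflict (p i) (q i) \<or> u i = p i \<or> u i = q i)"
proof -
  have "vdist n p u + vdist n u q = vdist n p q \<longleftrightarrow>
      (\<Sum>i\<in>{1..n}. s2_dist (p i) (u i) + s2_dist (u i) (q i) - s2_dist (p i) (q i)) = 0"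
  proof -
    have "vdist n p q + (\<Sum>i\<in>{1..n}. s2_dist (p i) (u i) + s2_dist (u i) (q i) - s2_dist (p i) (q i))
        = vdist n p u + vdist n u q"
      unfolding vdist_def sum.distrib[symmetric]
      by (intro sum.cong refl le_add_diff_inverse s2_dist_triangle)
    then show ?thesis by linarith
  qed
  also have "\<dots> \<longleftrightarrow> (\<forall>i\<in>{1..n}. s2_dist (p i) (u i) + s2_dist (u i) (q i) = s2_dist (p i) (q i))"
    using s2_dist_triangle by (auto simp: le_antisym)
  finally show ?thesis by (simp add: s2_dist_between)
qed

lemma vdist_upd:
  assumes "i \<in> {1..n}"
  shows "vdist n (p(i := s)) q + s2_dist (p i) (q i) = vdist n p q + s2_dist s (q i)"
proof -
  have "(\<Sum>j\<in>{1..n}-{i}. s2_dist ((p(i := s)) j) (q j)) = (\<Sum>j\<in>{1..n}-{i}. s2_dist (p j) (q j))"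
    by (intro sum.cong) auto
  moreover have "sum g {1..n} = g i + sum g ({1..n} - {i})" for g :: "nat \<Rightarrow> nat"
    using assms by (intro sum.remove) auto
  ultimately show ?thesis unfolding vdist_def by simp
qed

lemma S2n_upd: "p \<in> S2n n \<Longrightarrow> i \<in> {1..n} \<Longrightarrow> p(i := s) \<in> S2n n"
  by (auto simp: S2n_def)

lemma covers_upd:
  assumes "covers n p q"
  obtains i where "i \<in> {1..n}" "p i = Zer" "q i \<noteq> Zer" "q = p(i := q i)"
proof -
  have pq: "p \<in> S2n n" "q \<in> S2n n" "vec_le p q" "p \<noteq> q"
    and nb: "\<And>r. r \<in> S2n n \<Longrightarrow> vec_lt p r \<Longrightarrow> \<not> vec_lt r q"
    using assms by (auto simp: covers_def vec_lt_def)
  obtain i where i: "p i \<noteq> q i" using pq(4) by auto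
  have z: "p i = Zer" using pq(3) i by (auto simp: vec_le_def s2_le_def)
  have "i \<in> {1..n}" using i pq(1,2) S2nD by metis
  moreover have "vec_lt p (p(i := q i))"
    using i z by (auto simp: vec_lt_def vec_le_def s2_le_def fun_eq_iff)
  moreover have "vec_le (p(i := q i)) q"
    using pq(3) by (auto simp: vec_le_def s2_le_def)
  ultimately have "p(i := q i) = q"
    using nb[of "p(i := q i)"] S2n_upd[OF pq(1)] by (auto simp: vec_lt_def)
  then show ?thesis using that[of i] i z \<open>i \<in> {1..n}\<close> by metis
qed

lemma adj_upd:
  assumes "p \<in> S2n n" "i \<in> {1..n}" "p i = Zer" "s \<noteq> Zer"
  shows "covers n p (p(i := s))"
proof -
  have "r = p \<or> r = p(i := s)" if "vec_le p r" "vec_le r (p(i := s))" for r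
  proof -
    have "r j = p j" if "j \<noteq> i" for j
      using \<open>vec_le p r\<close> \<open>vec_le r (p(i := s))\<close> that
      by (auto simp: vec_le_def s2_le_def) metis
    moreover have "r i = p i \<or> r i = s"
      using \<open>vec_le r (p(i := s))\<close> assms(3) by (auto simp: vec_le_def s2_le_def dest: spec[of _ i])
    ultimately show ?thesis unfolding fun_eq_iff by (metis fun_upd_apply)
  qed
  moreover have "vec_le p (p(i := s))" "p \<noteq> p(i := s)"
    using assms by (auto simp: vec_le_def s2_le_def fun_eq_iff)
  ultimately show ?thesis
    using assms S2n_upd[of p n i s] by (auto simp: covers_def vec_lt_def)
qed

lemma adj_vdist:
  assumes "adj n p q"
  shows "vdist n p q \<le> 1"
proof -
  obtain i s where i: "i \<in> {1..n}" "q = p(i := s)" "\<not> s2_conflict (p i) s"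
    using assms unfolding adj_def
  proof
    assume "covers n p q"
    then obtain i where "i \<in> {1..n}" "p i = Zer" "q = p(i := q i)" by (rule covers_upd)
    then show ?thesis by (intro that[of i "q i"]) (auto simp: s2_conflict_def)
  next
    assume "covers n q p"
    then obtain i where i: "i \<in> {1..n}" "q i = Zer" "p = q(i := p i)" by (rule covers_upd)
    then have "q = p(i := Zer)" by (metis fun_upd_triv fun_upd_upd)
    with i show ?thesis by (intro that[of i Zer]) (auto simp: s2_conflict_def)
  qed
  have "vdist n p q = s2_dist (p i) s"
    using vdist_upd[OF i(1), of q "p i" q] i(2) vdist_upd[OF i(1), of p s q]
    by (simp add: s2_dist_def)
  then show ?thesis using i(3) by (simp add: s2_dist_def)
qed

lemma is_walk_successively:
  "is_walk n xs \<longleftrightarrow> xs \<noteq> [] \<and> set xs \<subseteq> S2n n \<and> successively (adj n) xs"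
  by (simp add: is_walk_def successively_conv_nth)

lemma walk_vdist:
  assumes "is_walk n xs"
  shows "vdist n (hd xs) (last xs) < length xs"
  using assms
proof (induction xs rule: induct_list012)
  case (3 x y zs)
  then have "vdist n y (last (y # zs)) < length (y # zs)" "vdist n x y \<le> 1"
    using adj_vdist by (auto simp: is_walk_successively)
  moreover have "vdist n x (last (y # zs)) \<le> vdist n x y + vdist n y (last (y # zs))"
    by (rule vdist_triangle)
  ultimately show ?case by simp
qed (auto simp: is_walk_def)

lemma walk_exists:
  assumes "p \<in> S2n n" "q \<in> S2n n"
  shows "\<exists>xs. is_walk n xs \<and> hd xs = p \<and> last xs = q \<and> length xs = Suc (vdist n p q)"
  using assms(1)
proof (induction "vdist n p q" arbitrary: p)
  case 0
  then have "\<forall>i\<in>{1..n}. p i = q i" by (auto simp: vdist_def s2_dist_def split: if_splits)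
  then have "p = q" using 0 assms(2) by (auto simp: fun_eq_iff S2n_def)
  then show ?case using 0 by (intro exI[of _ "[p]"]) (auto simp: is_walk_successively)
next
  case (Suc k)
  then have "\<exists>i\<in>{1..n}. p i \<noteq> q i"
    by (metis (no_types, lifting) vdist_def s2_dist_def sum.neutral nat.distinct(1))
  then obtain i where i: "i \<in> {1..n}" "p i \<noteq> q i" by blast
  \<comment> \<open>A descent and a conflict both begin by moving to \<open>Zer\<close>; only an
    ascent goes to \<open>q i\<close> at once.\<close>
  define s where "s = (if p i = Zer then q i else Zer)"
  have "s2_dist (p i) (q i) = Suc (s2_dist s (q i))"
    using i(2) by (cases "p i"; cases "q i") (auto simp: s_def s2_dist_def s2_defs)
  then have d: "vdist n (p(i := s)) q = k"
    using vdist_upd[OF i(1), of p s q] Suc(2) by simp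
  have S: "p(i := s) \<in> S2n n" using Suc.prems i by (auto intro: S2n_upd)
  have a: "adj n p (p(i := s))"
  proof (cases "p i = Zer")
    case True
    then show ?thesis using adj_upd[OF Suc.prems i(1), of s] i by (auto simp: adj_def s_def)
  next
    case False
    then show ?thesis using adj_upd[OF S i(1), of "p i"] by (auto simp: adj_def s_def)
  qed
  obtain xs where xs: "is_walk n xs" "hd xs = p(i := s)" "last xs = q" "length xs = Suc k"
    using Suc(1)[OF d[symmetric] S] d by auto
  then have "is_walk n (p # xs)"
    using a Suc.prems by (cases xs) (auto simp: is_walk_successively)
  then show ?case using xs Suc(2) by (intro exI[of _ "p # xs"]) (auto simp: is_walk_def)
qed

lemma gdist_eq:
  assumes "p \<in> S2n n" "q \<in> S2n n"
  shows "gdist n p q = vdist n p q"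
  unfolding gdist_def
proof (rule Least_equality)
  show "\<exists>xs. is_walk n xs \<and> hd xs = p \<and> last xs = q \<and> length xs = Suc (vdist n p q)"
    using walk_exists[OF assms] .
next
  fix k assume "\<exists>xs. is_walk n xs \<and> hd xs = p \<and> last xs = q \<and> length xs = Suc k"
  then show "vdist n p q \<le> k" using walk_vdist by fastforce
qed

text \<open>Lying on a shortest path means metric betweenness. A conflicting coordinate travels from
  one sign to the other through \<open>Zer\<close>, so all three values occur there.\<close>

lemma interval_eq:
  assumes p: "p \<in> S2n n" and q: "q \<in> S2n n"
  shows "interval n p q =
    {u \<in> S2n n. \<forall>i. s2_conflict (p i) (q i) \<or> u i = p i \<or> u i = q i}"
proof -
  have "u \<in> interval n p q \<longleftrightarrow> u \<in> S2n n \<and> vdist n p u + vdist n u q = vdist n p q" for u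
  proof
    assume "u \<in> interval n p q"
    then obtain xs where xs: "is_walk n xs" "hd xs = p" "last xs = q"
      "length xs = Suc (vdist n p q)" "u \<in> set xs"
      by (auto simp: interval_def gdist_eq[OF p q])
    obtain ys zs where e: "xs = ys @ u # zs" using split_list[OF xs(5)] by blast
    have "is_walk n (ys @ [u])" "is_walk n (u # zs)"
      using xs(1) unfolding e is_walk_successively
      by (auto simp: successively_append_iff)
    from this[THEN walk_vdist] have "vdist n p u \<le> length ys" "vdist n u q \<le> length zs"
      using xs(2,3) e by (auto simp: hd_append split: if_splits)
    moreover have "vdist n p q = length ys + length zs" using xs(4) e by simp
    moreover have "u \<in> S2n n" using xs by (auto simp: is_walk_def)
    ultimately show "u \<in> S2n n \<and> vdist n p u + vdist n u q = vdist n p q"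
      using vdist_triangle[of n p q u] by linarith
  next
    assume u: "u \<in> S2n n \<and> vdist n p u + vdist n u q = vdist n p q"
    obtain xs where xs: "is_walk n xs" "hd xs = p" "last xs = u" "length xs = Suc (vdist n p u)"
      using walk_exists[OF p, of u] u by blast
    obtain ys where ys: "is_walk n ys" "hd ys = u" "last ys = q" "length ys = Suc (vdist n u q)"
      using walk_exists[of u n q] u q by blast
    obtain zs where zs: "ys = u # zs" using ys by (cases ys) (auto simp: is_walk_def)
    have "is_walk n (xs @ zs)"
      using xs(1,3) ys(1) unfolding zs is_walk_successively
      by (cases zs) (auto simp: successively_append_iff)
    moreover have "hd (xs @ zs) = p" "last (xs @ zs) = q" "u \<in> set (xs @ zs)"
      using xs ys zs last_in_set[of xs] by (auto simp: is_walk_def last_append split: if_splits)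
    moreover have "length (xs @ zs) = Suc (vdist n p q)"
      using xs ys zs u by simp
    ultimately show "u \<in> interval n p q"
      by (auto simp: interval_def gdist_eq[OF p q])
  qed
  moreover have "(\<forall>i. s2_conflict (p i) (q i) \<or> u i = p i \<or> u i = q i) \<longleftrightarrow>
      (\<forall>i\<in>{1..n}. s2_conflict (p i) (q i) \<or> u i = p i \<or> u i = q i)" if "u \<in> S2n n" for u
    using that p q S2nD by metis
  ultimately show ?thesis unfolding vdist_between by blast
qed

section \<open>Extended-real inequalities and summation by parts\<close>

text \<open>No term is -\<infinity>, so the left side is infinite exactly when \<open>a\<close> or a
  value with positive coefficient is. Each extended inequality thus splits into membership in the
  domain and a real inequality.\<close>

lemma ereal_sum_le_iff:
  fixes g :: "'a \<Rightarrow> ereal" and a b :: ereal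
  assumes S: "finite S" and c: "\<And>s. s \<in> S \<Longrightarrow> 0 \<le> c s"
    and a: "a \<noteq> -\<infinity>" and g: "\<And>s. s \<in> S \<Longrightarrow> g s \<noteq> -\<infinity>" and b: "\<bar>b\<bar> \<noteq> \<infinity>"
  shows "a + (\<Sum>s\<in>S. ereal (c s) * g s) \<le> b \<longleftrightarrow>
    a \<noteq> \<infinity> \<and> (\<forall>s\<in>S. 0 < c s \<longrightarrow> g s \<noteq> \<infinity>) \<and>
    real_of_ereal a + (\<Sum>s\<in>S. c s * real_of_ereal (g s)) \<le> real_of_ereal b"
proof (cases "a \<noteq> \<infinity> \<and> (\<forall>s\<in>S. 0 < c s \<longrightarrow> g s \<noteq> \<infinity>)")
  case True
  have "ereal (c s) * g s = ereal (c s * real_of_ereal (g s))" if "s \<in> S" for s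
  proof (cases "c s = 0")
    case False
    then have "\<bar>g s\<bar> \<noteq> \<infinity>" using True c[OF that] g[OF that] that by auto
    then show ?thesis by (metis ereal_real times_ereal.simps(1))
  qed (simp add: zero_ereal_def[symmetric])
  then have "(\<Sum>s\<in>S. ereal (c s) * g s) = (\<Sum>s\<in>S. ereal (c s * real_of_ereal (g s)))"
    by (intro sum.cong) auto
  then have "(\<Sum>s\<in>S. ereal (c s) * g s) = ereal (\<Sum>s\<in>S. c s * real_of_ereal (g s))"
    by simp
  moreover obtain a' b' where "a = ereal a'" "b = ereal b'"
    using a b True by (cases a; cases b) auto
  ultimately show ?thesis using True by simp
next
  case False
  have n: "ereal (c s) * g s \<noteq> -\<infinity>" if "s \<in> S" for s
    using c[OF that] g[OF that] by (cases "g s") (auto simp: ereal_mult_eq_MInfty split: if_splits)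
  have "a + (\<Sum>s\<in>S. ereal (c s) * g s) = \<infinity>"
  proof (cases "a = \<infinity>")
    case False
    then obtain s where "s \<in> S" "0 < c s" "g s = \<infinity>"
      using \<open>\<not> (a \<noteq> \<infinity> \<and> _)\<close> by auto
    then have "(\<Sum>s\<in>S. ereal (c s) * g s) = \<infinity>"
      using S by (subst sum_Pinfty) (auto intro!: bexI[of _ s])
    then show ?thesis using a by simp
  qed simp
  then show ?thesis using False b by auto
qed

lemma vmeet_self [simp]: "vmeet p p = p"
  by (simp add: vmeet_def s2_tables)

text \<open>This form keeps the upper index of each increment, the next one the lower. The bound for
  \<open>vjoin_i k p q\<close> involves one function at \<open>Suc k\<close> and another at
  \<open>k\<close>, so both occur.\<close>

lemma sum_by_parts:
  fixes a X :: "nat \<Rightarrow> real"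
  shows "(\<Sum>i\<in>{0..n}. a i * (X (Suc i) - X i)) =
    a (Suc n) * X (Suc n) - a 0 * X 0 - (\<Sum>i\<in>{0..n}. (a (Suc i) - a i) * X (Suc i))"
  by (induction n) (simp_all add: algebra_simps)

lemma sum_by_parts':
  fixes a Y :: "nat \<Rightarrow> real"
  shows "(\<Sum>i\<in>{0..n}. a (Suc i) * (Y (Suc i) - Y i)) =
    a (Suc n) * Y (Suc n) - a 0 * Y 0 - (\<Sum>i\<in>{0..n}. (a (Suc i) - a i) * Y i)"
  by (induction n) (simp_all add: algebra_simps)

section \<open>Measuring cones\<close>

text \<open>The cone of weights whose normalised second entry y/(x+y) lies between \<open>lo\<close>
  and \<open>hi\<close>, multiplied out so that it makes sense at the origin.\<close>

definition slope_cone :: "real \<Rightarrow> real \<Rightarrow> (real \<times> real) set" where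
  "slope_cone lo hi = {(x, y). 0 \<le> x \<and> 0 \<le> y \<and> lo * (x + y) \<le> y \<and> y \<le> hi * (x + y)}"

text \<open>Adding \<open>y * sin a\<close> to both sides and dividing by
  \<open>sin a + cos a\<close>, which is positive on the quarter circle, turns a bound on the angle
  into a bound on y/(x+y).\<close>

lemma angle_cone_eq:
  fixes a b :: real
  assumes "0 \<le> b" "b \<le> a" "a \<le> pi / 2"
  shows "{(x, y). 0 \<le> x \<and> 0 \<le> y \<and> y * cos a \<le> x * sin a \<and> x * sin b \<le> y * cos b}
    = slope_cone (sin b / (sin b + cos b)) (sin a / (sin a + cos a))"
proof -
  have pos: "0 < sin t + cos t" if "0 \<le> t" "t \<le> pi / 2" for t :: real
  proof -
    have "0 \<le> sin t" "0 \<le> cos t" using that by (auto intro: sin_ge_zero cos_ge_zero)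
    moreover have "(sin t)\<^sup>2 + (cos t)\<^sup>2 = 1" by simp
    ultimately show ?thesis by (metis add_nonneg_eq_0_iff add_nonneg_nonneg add_0 less_eq_real_def power_zero_numeral zero_neq_one)
  qed
  have "0 < sin a + cos a" "0 < sin b + cos b" using pos assms by auto
  then have *: "y * cos a \<le> x * sin a \<longleftrightarrow> y \<le> sin a / (sin a + cos a) * (x + y)"
    "x * sin b \<le> y * cos b \<longleftrightarrow> sin b / (sin b + cos b) * (x + y) \<le> y" for x y
    by (simp_all add: field_simps)
  show ?thesis unfolding slope_cone_def by (simp only: * conj_ac)
qed

lemma slope_angle:
  fixes c :: real
  assumes "0 \<le> c" "c \<le> 1"
  obtains t where "0 \<le> t" "t \<le> pi / 2" "sin t / (sin t + cos t) = c"
proof -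
  have "continuous_on {0..pi/2} (\<lambda>t. sin t - c * (sin t + cos t))"
    by (intro continuous_intros)
  then have "\<exists>t\<ge>0. t \<le> pi/2 \<and> sin t - c * (sin t + cos t) = 0"
    using assms by (intro IVT') auto
  then obtain t where t: "0 \<le> t" "t \<le> pi/2" "sin t = c * (sin t + cos t)" by auto
  have "sin t + cos t \<noteq> 0"
  proof
    assume "sin t + cos t = 0"
    then have "sin t = 0" "cos t = 0" using t by auto
    then show False using sin_zero_abs_cos_one by fastforce
  qed
  then show ?thesis using that t by (metis nonzero_eq_divide_eq)
qed

text \<open>The segment of points \<open>(1 - c, c)\<close> meets the cone exactly where c lies
  between \<open>lo\<close> and \<open>hi\<close>, so the cone determines both.\<close>

lemma slope_cone_inj:
  assumes "slope_cone lo hi = slope_cone lo' hi'"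
    and "0 \<le> lo" "lo \<le> hi" "hi \<le> 1" "0 \<le> lo'" "lo' \<le> hi'" "hi' \<le> 1"
  shows "lo = lo' \<and> hi = hi'"
proof -
  have mem: "(1 - c, c) \<in> slope_cone l h \<longleftrightarrow> l \<le> c \<and> c \<le> h" if "0 \<le> c" "c \<le> 1" for c l h
    using that by (simp add: slope_cone_def)
  have "lo \<le> c \<and> c \<le> hi \<longleftrightarrow> lo' \<le> c \<and> c \<le> hi'" if "0 \<le> c" "c \<le> 1" for c
    using mem[OF that] assms(1) by metis
  from this[of lo] this[of hi] this[of lo'] this[of hi'] show ?thesis
    using assms(2-) by linarith
qed

text \<open>\<open>cone_measure\<close> works with an arbitrarily chosen pair of angles. Hence some
  pair must describe the cone, and every such pair must have the slopes \<open>lo\<close> and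
  \<open>hi\<close>.\<close>

lemma cone_measure_slope_cone:
  assumes "0 \<le> lo" "lo \<le> hi" "hi \<le> 1"
  shows "cone_measure (slope_cone lo hi) = hi - lo"
proof -
  define good where "good = (\<lambda>(a, b). 0 \<le> b \<and> b \<le> a \<and> a \<le> pi / 2 \<and> slope_cone lo hi =
    {(x, y). x \<ge> (0::real) \<and> y \<ge> 0 \<and> y * cos a \<le> x * sin a \<and> y * cos b \<ge> x * sin b})"
  have good: "good (a, b) \<longleftrightarrow> 0 \<le> b \<and> b \<le> a \<and> a \<le> pi / 2 \<and>
      slope_cone lo hi = slope_cone (sin b / (sin b + cos b)) (sin a / (sin a + cos a))" for a b
    using angle_cone_eq[of b a] by (auto simp: good_def)
  have mono: "sin b / (sin b + cos b) \<le> sin a / (sin a + cos a)"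
      "0 \<le> sin b / (sin b + cos b)" "sin a / (sin a + cos a) \<le> 1"
      "sin b / (sin b + cos b) = sin a / (sin a + cos a) \<Longrightarrow> a = b"
    if "0 \<le> b" "b \<le> a" "a \<le> pi/2" for a b :: real
  proof -
    have nn: "0 \<le> sin a" "0 \<le> cos a" "0 \<le> sin b" "0 \<le> cos b"
      using that by (auto intro: sin_ge_zero cos_ge_zero)
    \<comment> \<open>The cross-multiplied slopes differ by \<open>sin (a - b)\<close>, which
      settles monotonicity and injectivity together.\<close>
    have d: "sin (a - b) = sin a * cos b - cos a * sin b" by (rule sin_diff)
    have "0 \<le> sin (a - b)" using that by (intro sin_ge_zero) auto
    have pos: "0 < sin a + cos a" "0 < sin b + cos b"
      using nn sin_zero_abs_cos_one[of a] sin_zero_abs_cos_one[of b]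
      by (cases "sin a = 0"; cases "sin b = 0"; force)+
    show "0 \<le> sin b / (sin b + cos b)" "sin a / (sin a + cos a) \<le> 1" using nn pos by auto
    show "sin b / (sin b + cos b) \<le> sin a / (sin a + cos a)"
      using pos \<open>0 \<le> sin (a - b)\<close> unfolding d by (simp add: field_simps)
    assume "sin b / (sin b + cos b) = sin a / (sin a + cos a)"
    then have "sin (a - b) = 0" using pos unfolding d by (simp add: field_simps)
    moreover have "a - b < pi" using that pi_gt_zero by linarith
    ultimately show "a = b" using sin_gt_zero[of "a - b"] that by (cases "a = b") auto
  qed
  obtain a where a: "0 \<le> a" "a \<le> pi/2" "sin a / (sin a + cos a) = hi"
    using slope_angle[of hi] assms by auto
  obtain b where b: "0 \<le> b" "b \<le> pi/2" "sin b / (sin b + cos b) = lo"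
    using slope_angle[of lo] assms by auto
  have "b \<le> a"
  proof (rule ccontr)
    assume "\<not> b \<le> a"
    then have "a \<le> b" "a \<noteq> b" by auto
    then show False using mono(1)[of a b] mono(4)[of a b] a b assms by auto
  qed
  then have ab: "good (a, b)" using a b by (simp add: good)
  obtain a' b' where s: "(SOME ab. good ab) = (a', b')" by fastforce
  have "good (a', b')" using someI[of good, OF ab] s by simp
  then have g: "0 \<le> b'" "b' \<le> a'" "a' \<le> pi / 2"
      "slope_cone lo hi = slope_cone (sin b' / (sin b' + cos b')) (sin a' / (sin a' + cos a'))"
    by (simp_all add: good)
  have "lo = sin b' / (sin b' + cos b') \<and> hi = sin a' / (sin a' + cos a')"
    using slope_cone_inj[OF g(4)] mono[OF g(1-3)] assms by auto
  then show ?thesis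
    using s unfolding cone_measure_def good_def by simp
qed

lemma sorted_enumeration:
  fixes S :: "real set"
  assumes S: "finite S" "S \<subseteq> {0..1}" "0 \<in> S" "1 \<in> S"
  obtains m y where "S = y ` {..Suc m}" "y 0 = 0" "y (Suc m) = 1"
    "\<And>i j. i < j \<Longrightarrow> j \<le> Suc m \<Longrightarrow> y i < y j"
    "\<And>s j. j \<le> m \<Longrightarrow> s \<in> S \<Longrightarrow> s \<le> y j \<or> y (Suc j) \<le> s"
proof -
  define ys where "ys = sorted_list_of_set S"
  have ys: "set ys = S" "sorted_wrt (<) ys" "length ys = card S"
    using S by (auto simp: ys_def)
  have "card {0, 1::real} \<le> card S" using S by (intro card_mono) auto
  then have "2 \<le> length ys" using ys by simp
  \<comment> \<open>\<open>m\<close> counts the points strictly between the endpoints 0 and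
    1.\<close>
  define m where "m = length ys - 2"
  have len: "length ys = Suc (Suc m)" using \<open>2 \<le> length ys\<close> by (simp add: m_def)
  have lt: "ys ! i < ys ! j" if "i < j" "j \<le> Suc m" for i j
    using sorted_wrt_nth_less[OF ys(2)] that len by simp
  have le: "ys ! i \<le> ys ! j" if "i \<le> j" "j \<le> Suc m" for i j
    using lt[of i j] that by (cases "i = j") auto
  have img: "S = (!) ys ` {..Suc m}"
    using ys(1) len by (auto simp: set_conv_nth image_iff less_Suc_eq_le Bex_def)
  obtain i j where ij: "i \<le> Suc m" "0 = ys ! i" "j \<le> Suc m" "1 = ys ! j"
    using S(3,4) img by auto
  have "ys ! 0 \<in> S" "ys ! Suc m \<in> S" using img by auto
  then have "ys ! 0 = 0" "ys ! Suc m = 1"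
    using le[of 0 i] le[of j "Suc m"] ij S(2) by auto
  moreover have "s \<le> ys ! j \<or> ys ! Suc j \<le> s" if "j \<le> m" and sS: "s \<in> S" for s j
  proof -
    obtain i where "i \<le> Suc m" "s = ys ! i" using sS by (metis img imageE atMost_iff)
    then show ?thesis using le[of i j] le[of "Suc j" i] that by (cases "i \<le> j") auto
  qed
  ultimately show ?thesis using that[of "(!) ys" m] img lt by blast
qed

section \<open>Weights, cuts of the index set and thresholds\<close>

locale alpha_weights =
  fixes n :: nat and \<alpha> :: "nat \<Rightarrow> real"
  assumes alpha_pos: "i \<in> {1..n} \<Longrightarrow> 0 < \<alpha> i"
    and alpha_le_1: "i \<in> {1..n} \<Longrightarrow> \<alpha> i \<le> 1"
    and alpha_mono: "i \<in> {1..n} \<Longrightarrow> j \<in> {1..n} \<Longrightarrow> i \<le> j \<Longrightarrow> \<alpha> i \<le> \<alpha> j"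
begin

abbreviation "ae \<equiv> alpha_ext n \<alpha>"
abbreviation "fdom f \<equiv> {p \<in> S2n n. f p \<noteq> (\<infinity>::ereal)}"
abbreviation "th p i \<equiv> thr (\<alpha> i) (p i)"

lemma ae_simps [simp]: "ae 0 = 0" "ae (Suc n) = 1" "i \<in> {1..n} \<Longrightarrow> ae i = \<alpha> i"
  by (auto simp: alpha_ext_def)

lemma ae_mono:
  assumes "i \<le> j" "j \<le> Suc n"
  shows "ae i \<le> ae j"
  using assms alpha_mono[of i j] alpha_le_1[of i] alpha_pos[of j]
  by (auto simp: alpha_ext_def)

lemma ae_bounds: "i \<le> Suc n \<Longrightarrow> 0 \<le> ae i \<and> ae i \<le> 1"
  using ae_mono[of 0 i] ae_mono[of i "Suc n"] by simp

lemma ae_Suc: "k \<in> {0..n} \<Longrightarrow> 0 \<le> ae (k + 1) - ae k"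
  using ae_mono[of k "k + 1"] by simp

text \<open>A vanishing increment makes the index irrelevant, so the index may be replaced
  by the threshold it stands for.\<close>
lemma ae_le_iff:
  assumes "ae k < ae (Suc k)" "k \<le> n" "i \<in> {1..n}"
  shows "i \<le> k \<longleftrightarrow> \<alpha> i \<le> ae k" and "i \<le> k \<longleftrightarrow> \<alpha> i < ae (Suc k)"
  using ae_mono[of i k] ae_mono[of "Suc k" i] assms by (cases "i \<le> k"; force)+

text \<open>Bisubmodularity puts \<open>vjoin_i k p q\<close> into the domain only for a positive
  increment, so a cut at an arbitrary level has to be realised by such an index: the last one whose
  weight does not exceed the level. Thresholds rise with \<alpha> for \<open>Neg\<close> and fall
  for \<open>Pos\<close>, hence the strict variant below.\<close>

lemma ae_cut_le:
  assumes "T < 1" "0 \<le> T"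
  obtains k where "k \<le> n" "ae k < ae (Suc k)" "\<And>i. i \<in> {1..n} \<Longrightarrow> i \<le> k \<longleftrightarrow> \<alpha> i \<le> T"
proof -
  define k where "k = (GREATEST k. k \<le> n \<and> ae k \<le> T)"
  have k: "k \<le> n \<and> ae k \<le> T"
    unfolding k_def by (rule GreatestI_nat[of _ 0 n]) (use assms in auto)
  have "\<not> (Suc k \<le> n \<and> ae (Suc k) \<le> T)"
    using Greatest_le_nat[of "\<lambda>k. k \<le> n \<and> ae k \<le> T" "Suc k" n] unfolding k_def by auto
  then have T: "T < ae (Suc k)"
    using k assms by (cases "k = n") auto
  then have "ae k < ae (Suc k)" using k by simp
  moreover have "i \<le> k \<longleftrightarrow> \<alpha> i \<le> T" if "i \<in> {1..n}" for i
    using ae_mono[of i k] ae_mono[of "Suc k" i] that k T by (cases "i \<le> k") force+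
  ultimately show ?thesis using that k by blast
qed

lemma ae_cut_less:
  assumes "0 < T" "T \<le> 1"
  obtains k where "k \<le> n" "ae k < ae (Suc k)" "\<And>i. i \<in> {1..n} \<Longrightarrow> i \<le> k \<longleftrightarrow> \<alpha> i < T"
proof -
  define k where "k = (GREATEST k. k \<le> n \<and> ae k < T)"
  have k: "k \<le> n \<and> ae k < T"
    unfolding k_def by (rule GreatestI_nat[of _ 0 n]) (use assms in auto)
  have "\<not> (Suc k \<le> n \<and> ae (Suc k) < T)"
    using Greatest_le_nat[of "\<lambda>k. k \<le> n \<and> ae k < T" "Suc k" n] unfolding k_def by auto
  then have T: "T \<le> ae (Suc k)"
    using k assms by (cases "k = n") auto
  then have "ae k < ae (Suc k)" using k by simp
  moreover have "i \<le> k \<longleftrightarrow> \<alpha> i < T" if "i \<in> {1..n}" for i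
    using ae_mono[of i k] ae_mono[of "Suc k" i] that k T by (cases "i \<le> k") force+
  ultimately show ?thesis using that k by blast
qed

text \<open>Because \<alpha> is at most 1, the value 1/2 separates the thresholds of
  \<open>Pos\<close> from those of \<open>Neg\<close>; on either side of it only one sign of
  \<open>p i\<close> is left undecided.\<close>

lemma thr_bounds:
  assumes "i \<in> {1..n}"
  shows "0 < thr (\<alpha> i) s" "thr (\<alpha> i) s < 1"
    "s = Pos \<Longrightarrow> 1/2 \<le> thr (\<alpha> i) s" "s \<noteq> Pos \<Longrightarrow> thr (\<alpha> i) s \<le> 1/2"
  using alpha_pos[OF assms] alpha_le_1[OF assms] by (auto simp: thr_def field_simps)

lemma less_thr:
  assumes "0 < a"
  shows "0 < \<tau> \<Longrightarrow> \<tau> < thr a Pos \<longleftrightarrow> a < 1/\<tau> - 1"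
    and "\<tau> < 1 \<Longrightarrow> s \<noteq> Pos \<Longrightarrow> \<tau> < thr a s \<longleftrightarrow> \<not> a \<le> \<tau>/(1-\<tau>)"
  using assms by (auto simp: thr_def field_simps)

lemma thr_eq:
  assumes "0 < a"
  shows "thr a Pos = c \<Longrightarrow> a = 1/c - 1"
    and "s \<noteq> Pos \<Longrightarrow> thr a s = c \<Longrightarrow> a = c/(1-c)"
proof -
  show "a = 1/c - 1" if "thr a Pos = c"
    using assms that[symmetric] by (simp add: thr_def)
  show "a = c/(1-c)" if "s \<noteq> Pos" "thr a s = c"
  proof -
    have "1 - c = 1 / (1 + a)" using assms that by (auto simp: thr_def field_simps)
    then show ?thesis using assms that by (auto simp: thr_def)
  qed
qed

definition threshold_enum :: "(nat \<Rightarrow> s2) \<Rightarrow> (nat \<Rightarrow> s2) \<Rightarrow> nat \<Rightarrow> (nat \<Rightarrow> real) \<Rightarrow> bool" where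
  "threshold_enum p q m y \<longleftrightarrow> y 0 = 0 \<and> y (Suc m) = 1 \<and>
     (\<forall>i j. i < j \<longrightarrow> j \<le> Suc m \<longrightarrow> y i < y j) \<and>
     (\<forall>i. s2_conflict (p i) (q i) \<longrightarrow> th p i \<in> y ` {1..m} \<and>
        (\<forall>j\<le>m. th p i \<le> y j \<or> y (Suc j) \<le> th p i))"

lemma threshold_enumD:
  assumes "threshold_enum p q m y"
  shows "y 0 = 0" "y (Suc m) = 1" "i < j \<Longrightarrow> j \<le> Suc m \<Longrightarrow> y i < y j"
    and "i \<le> j \<Longrightarrow> j \<le> Suc m \<Longrightarrow> y i \<le> y j"
    and "s2_conflict (p i) (q i) \<Longrightarrow> th p i \<in> y ` {1..m}"
    and "s2_conflict (p i) (q i) \<Longrightarrow> j \<le> m \<Longrightarrow> th p i \<le> y j \<or> y (Suc j) \<le> th p i"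
  using assms by (auto simp: threshold_enum_def le_less)

section \<open>Vertices of the convex hull and their cones\<close>

context
  fixes p q
  assumes p: "p \<in> S2n n" and q: "q \<in> S2n n"
begin

text \<open>The contribution of coordinate \<open>i\<close> to \<open>vpt\<close> when
  \<open>u i = s\<close>; changing one coordinate moves the point by a difference of gains.\<close>

definition gain :: "nat \<Rightarrow> s2 \<Rightarrow> real \<times> real" where
  "gain i s = (vcoord \<alpha> i (s2_meet s (p i)) - vcoord \<alpha> i (s2_meet (p i) (q i)),
    vcoord \<alpha> i (s2_meet s (q i)) - vcoord \<alpha> i (s2_meet (p i) (q i)))"

definition weight :: "nat \<Rightarrow> real" where
  "weight i = vcoord \<alpha> i (p i) + vcoord \<alpha> i (q i)"

abbreviation "V \<equiv> vpt n \<alpha> p q"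
abbreviation "Ip \<equiv> interval n p q"
abbreviation "conf i \<equiv> s2_conflict (p i) (q i)"
abbreviation "M \<tau> \<equiv> mix \<alpha> \<tau> p q"

lemma conf_index: "conf i \<Longrightarrow> i \<in> {1..n}"
  using s2_conflict_index[OF p] .

lemma conf_thr: "conf i \<Longrightarrow> 0 < th p i \<and> th p i < 1"
  using thr_bounds conf_index by simp

lemma V_eq: "V u = (\<Sum>i\<in>{1..n}. gain i (u i))"
  by (simp add: vpt_def val_def gain_def vmeet_def prod_eq_iff fst_sum snd_sum sum_subtractf)

lemma V_upd:
  assumes "i \<in> {1..n}"
  shows "V (u(i := s)) = V u + (gain i s - gain i (u i))"
proof -
  have "(\<Sum>j\<in>{1..n}-{i}. gain j ((u(i := s)) j)) = (\<Sum>j\<in>{1..n}-{i}. gain j (u j))"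
    by (intro sum.cong) auto
  moreover have "sum g {1..n} = g i + sum g ({1..n} - {i})" for g :: "nat \<Rightarrow> real \<times> real"
    using assms by (intro sum.remove) auto
  ultimately show ?thesis unfolding V_eq by simp
qed

lemma weight_pos: "conf i \<Longrightarrow> 0 < weight i"
  using alpha_pos[OF conf_index, of i]
  by (cases "p i"; cases "q i") (auto simp: weight_def vcoord_def s2_tables)

text \<open>At a conflict the meet is \<open>Zer\<close>, so \<open>p i\<close> scores only on the
  first axis and \<open>q i\<close> only on the second; the threshold is the share of
  \<open>p i\<close> in the total weight.\<close>

lemma gain_conf:
  assumes "conf i"
  shows "gain i (p i) = (weight i * th p i, 0)"
    and "gain i (q i) = (0, weight i * (1 - th p i))"
    and "gain i Zer = 0"
  using assms alpha_pos[OF conf_index[OF assms]]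
  by (cases "p i"; cases "q i";
      simp add: gain_def weight_def vcoord_def thr_def s2_tables field_simps prod_eq_iff)+

lemma gain_nonconf:
  assumes "\<not> conf i" "s = p i \<or> s = q i" "i \<in> {1..n}"
  shows "fst (gain i s) \<le> fst (gain i (s2_join (p i) (q i)))"
    and "snd (gain i s) \<le> snd (gain i (s2_join (p i) (q i)))"
    and "gain i s = gain i (s2_join (p i) (q i)) \<Longrightarrow> s = s2_join (p i) (q i)"
  using assms alpha_pos[OF assms(3)]
  by (cases "p i"; cases "q i";
      auto simp: gain_def weight_def vcoord_def s2_tables prod_eq_iff)+

lemma Ip_eq: "Ip = {u \<in> S2n n. \<forall>i. conf i \<or> u i = p i \<or> u i = q i}"
  by (rule interval_eq[OF p q])

lemma Ip_upd: "u \<in> Ip \<Longrightarrow> i \<in> {1..n} \<Longrightarrow> conf i \<or> s = p i \<or> s = q i \<Longrightarrow> u(i := s) \<in> Ip"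
  by (auto simp: Ip_eq S2n_def)

lemma mix_Ip: "M \<tau> \<in> Ip"
  using mix_S2n[OF p q] by (auto simp: Ip_eq mix_def s2_defs)

lemma V_conv: "u \<in> Ip \<Longrightarrow> V u \<in> convI n \<alpha> p q"
  unfolding convI_def by (intro hull_inc) auto

text \<open>A linear functional splits over coordinates. At a conflict \<open>Zer\<close> scores 0,
  and which of \<open>p i\<close> and \<open>q i\<close> scores more depends on comparing
  \<open>snd w\<close> with \<open>th p i * (fst w + snd w)\<close>.\<close>

lemma functional_mono:
  fixes w :: "real \<times> real"
  assumes w: "0 \<le> fst w" "0 \<le> snd w" and u: "u \<in> Ip"
    and c: "\<And>i. conf i \<Longrightarrow> \<tau> < th p i \<Longrightarrow> snd w \<le> th p i * (fst w + snd w)"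
      "\<And>i. conf i \<Longrightarrow> th p i \<le> \<tau> \<Longrightarrow> th p i * (fst w + snd w) \<le> snd w"
  shows "w \<bullet> V u \<le> w \<bullet> V (M \<tau>)"
  unfolding V_eq inner_sum_right
proof (rule sum_mono)
  fix i assume i: "i \<in> {1..n}"
  show "w \<bullet> gain i (u i) \<le> w \<bullet> gain i (M \<tau> i)"
  proof (cases "conf i")
    case False
    then have "u i = p i \<or> u i = q i" using u by (auto simp: Ip_eq)
    note g = gain_nonconf(1,2)[OF False this i]
    have "M \<tau> i = s2_join (p i) (q i)" using False by (simp add: mix_def)
    then show ?thesis using g w by (simp add: inner_prod_def add_mono mult_left_mono)
  next
    case True
    have P: "w \<bullet> gain i (p i) = weight i * (th p i * fst w)"
      and Q: "w \<bullet> gain i (q i) = weight i * ((1 - th p i) * snd w)"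
      and Z: "w \<bullet> gain i Zer = 0"
      using gain_conf[OF True] by (simp_all add: inner_prod_def mult_ac)
    have nn: "0 \<le> weight i * (th p i * fst w)" "0 \<le> weight i * ((1 - th p i) * snd w)"
      using weight_pos[OF True] conf_thr[OF True] w by (auto intro!: mult_nonneg_nonneg)
    have "u i = p i \<or> u i = q i \<or> u i = Zer"
      using True by (cases "p i"; cases "q i"; cases "u i") (auto simp: s2_tables)
    moreover have "w \<bullet> gain i (p i) \<le> w \<bullet> gain i (M \<tau> i) \<and> w \<bullet> gain i (q i) \<le> w \<bullet> gain i (M \<tau> i)"
    proof (cases "\<tau> < th p i")
      case t: True
      then have "M \<tau> i = p i" using True by (simp add: mix_def)
      moreover have "(1 - th p i) * snd w \<le> th p i * fst w"
        using c(1)[OF True t] by (simp add: algebra_simps)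
      ultimately show ?thesis using weight_pos[OF True] P Q by simp
    next
      case t: False
      then have "M \<tau> i = q i" using True by (simp add: mix_def)
      moreover have "th p i * fst w \<le> (1 - th p i) * snd w"
        using c(2)[OF True] t by (simp add: algebra_simps)
      ultimately show ?thesis using weight_pos[OF True] P Q by simp
    qed
    ultimately show ?thesis using nn P Q Z by force
  qed
qed

text \<open>\<open>lo\<close> and \<open>hi\<close> are the thresholds next to \<tau>, or 0 and 1
  where there is none. For a nonnegative weight outside the slope cone, switching one coordinate
  with such a threshold raises the functional; inside, \<open>functional_mono\<close>
  applies.\<close>

lemma Ccone_mix:
  assumes lo: "\<And>i. conf i \<Longrightarrow> th p i \<le> \<tau> \<longleftrightarrow> th p i \<le> lo" "lo = 0 \<or> lo \<in> th p ` {i. conf i}"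
    and hi: "\<And>i. conf i \<Longrightarrow> \<tau> < th p i \<longleftrightarrow> hi \<le> th p i" "hi = 1 \<or> hi \<in> th p ` {i. conf i}"
  shows "Ccone n \<alpha> p q (M \<tau>) = slope_cone lo hi"
proof -
  have "w \<in> Ccone n \<alpha> p q (M \<tau>) \<longleftrightarrow> w \<in> slope_cone lo hi" for w
  proof
    assume "w \<in> Ccone n \<alpha> p q (M \<tau>)"
    then have w: "0 \<le> fst w" "0 \<le> snd w" and
      max: "\<And>z. z \<in> convI n \<alpha> p q \<Longrightarrow> w \<bullet> z \<le> w \<bullet> V (M \<tau>)"
      by (auto simp: Ccone_def inner_prod_def)
    have sw: "w \<bullet> gain i s \<le> w \<bullet> gain i (M \<tau> i)" if "conf i" for i s
    proof -
      have "w \<bullet> V ((M \<tau>)(i := s)) \<le> w \<bullet> V (M \<tau>)"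
        using that by (intro max V_conv Ip_upd mix_Ip conf_index) auto
      then show ?thesis
        unfolding V_upd[OF conf_index[OF that]] by (simp add: inner_add_right inner_diff_right)
    qed
    have cmp: "w \<bullet> gain i (p i) \<le> w \<bullet> gain i (q i) \<longleftrightarrow> th p i * (fst w + snd w) \<le> snd w"
      "w \<bullet> gain i (q i) \<le> w \<bullet> gain i (p i) \<longleftrightarrow> snd w \<le> th p i * (fst w + snd w)"
      if "conf i" for i
    proof -
      have P: "w \<bullet> gain i (p i) = weight i * (th p i * fst w)"
        and Q: "w \<bullet> gain i (q i) = weight i * ((1 - th p i) * snd w)"
        using gain_conf[OF that] by (simp_all add: inner_prod_def mult_ac)
      show "w \<bullet> gain i (p i) \<le> w \<bullet> gain i (q i) \<longleftrightarrow> th p i * (fst w + snd w) \<le> snd w"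
        "w \<bullet> gain i (q i) \<le> w \<bullet> gain i (p i) \<longleftrightarrow> snd w \<le> th p i * (fst w + snd w)"
        unfolding P Q mult_le_cancel_left_pos[OF weight_pos[OF that]] by (simp_all add: algebra_simps)
    qed
    have "lo * (fst w + snd w) \<le> snd w"
      using lo(2)
    proof
      assume "lo \<in> th p ` {i. conf i}"
      then obtain i where i: "conf i" "lo = th p i" by auto
      then have "M \<tau> i = q i" using lo(1)[OF i(1)] by (simp add: mix_def)
      then show ?thesis using sw[OF i(1), of "p i"] cmp(1)[OF i(1)] i(2) by simp
    qed (use w in simp)
    moreover have "snd w \<le> hi * (fst w + snd w)"
      using hi(2)
    proof
      assume "hi \<in> th p ` {i. conf i}"
      then obtain i where i: "conf i" "hi = th p i" by auto
      then have "M \<tau> i = p i" using hi(1)[OF i(1)] by (simp add: mix_def)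
      then show ?thesis using sw[OF i(1), of "q i"] cmp(2)[OF i(1)] i(2) by simp
    qed (use w in simp)
    ultimately show "w \<in> slope_cone lo hi"
      using w by (simp add: slope_cone_def split_beta)
  next
    assume "w \<in> slope_cone lo hi"
    then have w: "0 \<le> fst w" "0 \<le> snd w" "lo * (fst w + snd w) \<le> snd w"
        "snd w \<le> hi * (fst w + snd w)"
      by (auto simp: slope_cone_def)
    have "w \<bullet> V u \<le> w \<bullet> V (M \<tau>)" if "u \<in> Ip" for u
    proof (rule functional_mono[OF w(1,2) that])
      fix i assume i: "conf i" "\<tau> < th p i"
      then have "hi * (fst w + snd w) \<le> th p i * (fst w + snd w)"
        using hi(1) w by (intro mult_right_mono) auto
      then show "snd w \<le> th p i * (fst w + snd w)" using w by linarith
    next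
      fix i assume i: "conf i" "th p i \<le> \<tau>"
      then have "th p i * (fst w + snd w) \<le> lo * (fst w + snd w)"
        using lo(1) w by (intro mult_right_mono) auto
      then show "th p i * (fst w + snd w) \<le> snd w" using w by linarith
    qed
    then have "convI n \<alpha> p q \<subseteq> {z. w \<bullet> z \<le> w \<bullet> V (M \<tau>)}"
      unfolding convI_def by (intro hull_minimal convex_halfspace_le) auto
    then show "w \<in> Ccone n \<alpha> p q (M \<tau>)"
      using w by (auto simp: Ccone_def inner_prod_def)
  qed
  then show ?thesis by blast
qed

text \<open>A point maximising two linearly independent positive functionals is extreme.\<close>
lemma mix_Ecal:
  assumes cone: "Ccone n \<alpha> p q (M \<tau>) = slope_cone lo hi"
    and lh: "0 \<le> lo" "lo < hi" "hi \<le> 1"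
  shows "M \<tau> \<in> Ecal n \<alpha> p q"
proof -
  let ?C = "convI n \<alpha> p q" and ?v = "V (M \<tau>)"
  define c d where "c = lo + (hi - lo) / 3" and "d = hi - (hi - lo) / 3"
  have cd: "lo < c" "c < d" "d < hi" using lh by (auto simp: c_def d_def field_simps)
  have mem: "(1 - t, t) \<in> Ccone n \<alpha> p q (M \<tau>)" if "t = c \<or> t = d" for t
    using that cd lh unfolding cone slope_cone_def by auto
  have max: "(1 - t) * fst z + t * snd z \<le> (1 - t) * fst ?v + t * snd ?v"
    if "t = c \<or> t = d" "z \<in> ?C" for t z
    using mem[OF that(1)] that(2) by (auto simp: Ccone_def)
  have "?v extreme_point_of ?C"
    unfolding extreme_point_of_def
  proof (intro conjI ballI notI)
    show "?v \<in> ?C" using V_conv mix_Ip by blast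
    fix a b assume ab: "a \<in> ?C" "b \<in> ?C" "?v \<in> open_segment a b"
    then obtain s where s: "0 < s" "s < 1" "?v = (1 - s) *\<^sub>R a + s *\<^sub>R b" and "a \<noteq> b"
      by (auto simp: in_segment)
    have eq: "(1 - t) * fst a + t * snd a = (1 - t) * fst ?v + t * snd ?v"
      if t: "t = c \<or> t = d" for t
    proof (rule antisym[OF max[OF t ab(1)]])
      define L where "L z = (1 - t) * fst z + t * snd z" for z
      have "L ?v = (1 - s) * L a + s * L b"
        unfolding s(3) L_def by (simp add: algebra_simps)
      moreover have "s * L b \<le> s * L ?v"
        using max[OF t ab(2)] s by (simp add: L_def)
      ultimately have "(1 - s) * L ?v \<le> (1 - s) * L a" by (simp add: algebra_simps)
      then show "(1 - t) * fst ?v + t * snd ?v \<le> (1 - t) * fst a + t * snd a"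
        using s by (simp add: L_def)
    qed
    define e where "e = a - ?v"
    have "(1 - c) * fst e + c * snd e = 0" "(1 - d) * fst e + d * snd e = 0"
      using eq[of c] eq[of d] by (simp_all add: e_def algebra_simps)
    then have ce: "fst e = c * (fst e - snd e)" and de: "fst e = d * (fst e - snd e)"
      by (simp_all add: algebra_simps)
    then have "(d - c) * (fst e - snd e) = 0" by (simp add: algebra_simps)
    then have "fst e = 0" "snd e = 0" using cd ce by auto
    then have "a = ?v" by (simp add: e_def prod_eq_iff)
    then have "s *\<^sub>R a = s *\<^sub>R b" using s(3) by (simp add: algebra_simps)
    then show False using s(1) \<open>a \<noteq> b\<close> by simp
  qed
  moreover have "cw_maximal ?C ?v"
    unfolding cw_maximal_def
  proof (intro conjI notI)
    show "?v \<in> ?C" using V_conv mix_Ip by blast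
    assume "\<exists>z\<in>?C. fst ?v \<le> fst z \<and> snd ?v \<le> snd z \<and> z \<noteq> ?v"
    then obtain z where z: "z \<in> ?C" "fst ?v \<le> fst z" "snd ?v \<le> snd z" "z \<noteq> ?v" by blast
    have "0 < c" "c < 1" using cd lh by auto
    then have "(1 - c) * fst ?v \<le> (1 - c) * fst z" "c * snd ?v \<le> c * snd z"
      using z by auto
    then have "(1 - c) * fst ?v = (1 - c) * fst z" "c * snd ?v = c * snd z"
      using max[of c z] z(1) by linarith+
    then show False using \<open>0 < c\<close> \<open>c < 1\<close> z(4) by (simp add: prod_eq_iff)
  qed
  ultimately show ?thesis using mix_Ip by (simp add: Ecal_def)
qed

text \<open>Exchange argument: if a vertex took \<open>p i\<close> and \<open>q k\<close> although \<open>i\<close> has the smaller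
  threshold, suitable shares of the two reversals would dominate it, or cancel.\<close>
lemma Ecal_exchange:
  assumes u: "u \<in> Ecal n \<alpha> p q" and i: "conf i" "u i = p i" and k: "conf k" "u k = q k"
  shows "th p k < th p i"
proof (rule ccontr)
  assume "\<not> th p k < th p i"
  then have le: "th p i \<le> th p k" by simp
  let ?C = "convI n \<alpha> p q" and ?v = "V u"
  have uI: "u \<in> Ip" and ext: "?v extreme_point_of ?C" and mx: "cw_maximal ?C ?v"
    using u by (auto simp: Ecal_def)
  define a b where "a = V (u(i := q i))" and "b = V (u(k := p k))"
  have ab: "a \<in> ?C" "b \<in> ?C"
    unfolding a_def b_def using i k by (auto intro!: V_conv Ip_upd uI conf_index)
  have a: "a = ?v + weight i *\<^sub>R (- th p i, 1 - th p i)"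
    unfolding a_def V_upd[OF conf_index[OF i(1)]] i(2) gain_conf[OF i(1)] by simp
  have b: "b = ?v + weight k *\<^sub>R (th p k, - (1 - th p k))"
    unfolding b_def V_upd[OF conf_index[OF k(1)]] k(2) gain_conf[OF k(1)] by (simp add: algebra_simps)
  note wp = weight_pos[OF i(1)] weight_pos[OF k(1)]
  \<comment> \<open>The shares scale both reversals to the same factor \<open>r\<close>, so that
    their sum is a multiple of (1,1).\<close>
  define s where "s = weight i / (weight i + weight k)"
  have s: "0 < s" "s < 1" using wp by (auto simp: s_def)
  define z where "z = (1 - s) *\<^sub>R a + s *\<^sub>R b"
  define r where "r = weight i * weight k / (weight i + weight k)"
  have r: "0 < r" "(1 - s) * weight i = r" "s * weight k = r"
    using wp by (auto simp: r_def s_def field_simps)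
  have z: "z = ?v + (r * (th p k - th p i)) *\<^sub>R (1, 1)"
  proof -
    have "z = ?v + ((1 - s) * weight i) *\<^sub>R (- th p i, 1 - th p i) + (s * weight k) *\<^sub>R (th p k, - (1 - th p k))"
      unfolding z_def a b by (simp add: algebra_simps)
    then show ?thesis unfolding r by (simp add: prod_eq_iff algebra_simps)
  qed
  have zC: "z \<in> ?C"
    unfolding z_def using ab s convex_convex_hull
    by (auto simp: convI_def intro!: convexD_alt)
  show False
  proof (cases "th p i = th p k")
    case True
    then have "?v = (1 - s) *\<^sub>R a + s *\<^sub>R b" using z by (simp add: z_def zero_prod_def[symmetric])
    moreover have "a \<noteq> b"
    proof
      assume "a = b"
      then have "weight i * th p i + weight k * th p k = 0"
        unfolding a b by (simp add: prod_eq_iff)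
      then show False using wp conf_thr[OF i(1)] conf_thr[OF k(1)]
        by (metis add_pos_pos mult_pos_pos less_irrefl)
    qed
    ultimately have "?v \<in> open_segment a b" using s by (auto simp: in_segment)
    then show False using ext ab by (auto simp: extreme_point_of_def)
  next
    case False
    then have "0 < r * (th p k - th p i)" using le r by simp
    then have "fst ?v \<le> fst z" "snd ?v \<le> snd z" "z \<noteq> ?v"
      unfolding z by (auto simp: prod_eq_iff)
    then show False using mx zC by (auto simp: cw_maximal_def)
  qed
qed

text \<open>Maximality forces the join at the other coordinates and excludes \<open>Zer\<close> at
  conflicts. By the exchange argument, the conflicts resolved to \<open>q\<close> have smaller
  thresholds than those resolved to \<open>p\<close>.\<close>

lemma Ecal_imp_mix:
  assumes u: "u \<in> Ecal n \<alpha> p q"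
  obtains \<tau> where "0 \<le> \<tau>" "\<tau> < 1" "u = M \<tau>"
proof -
  have uI: "u \<in> Ip" and mx: "cw_maximal (convI n \<alpha> p q) (V u)"
    using u by (auto simp: Ecal_def)
  have dom: "False" if "i \<in> {1..n}" "conf i \<or> s = p i \<or> s = q i"
    "fst (gain i (u i)) \<le> fst (gain i s)" "snd (gain i (u i)) \<le> snd (gain i s)"
    "gain i s \<noteq> gain i (u i)" for i s
  proof -
    have "V (u(i := s)) \<in> convI n \<alpha> p q" using that uI by (intro V_conv Ip_upd)
    moreover have "fst (V u) \<le> fst (V (u(i := s)))" "snd (V u) \<le> snd (V (u(i := s)))"
      "V (u(i := s)) \<noteq> V u"
      unfolding V_upd[OF that(1)] using that by auto
    ultimately show False using mx by (auto simp: cw_maximal_def)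
  qed
  have nc: "u i = s2_join (p i) (q i)" if c: "\<not> conf i" for i
  proof (cases "i \<in> {1..n}")
    case True
    have "u i = p i \<or> u i = q i" using uI c by (auto simp: Ip_eq)
    note g = gain_nonconf[OF c this True]
    have "s2_join (p i) (q i) = p i \<or> s2_join (p i) (q i) = q i"
      using c by (auto simp: s2_defs)
    then show ?thesis using dom[OF True, of "s2_join (p i) (q i)"] g by metis
  next
    case False
    then show ?thesis using S2nD[OF p False] S2nD[OF q False] uI
      by (auto simp: Ip_eq s2_tables dest: S2nD)
  qed
  have cf: "u i = p i \<or> u i = q i" if c: "conf i" for i
  proof (rule ccontr)
    assume "\<not> (u i = p i \<or> u i = q i)"
    then have z: "u i = Zer" using c by (cases "p i"; cases "q i"; cases "u i") (auto simp: s2_tables)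
    have "0 < weight i" "0 < th p i" using weight_pos[OF c] conf_thr[OF c] by auto
    then show False using dom[OF conf_index[OF c], of "p i"] c z
      gain_conf(1)[OF c] gain_conf(3)[OF c] by (auto simp: prod_eq_iff)
  qed
  define B where "B = {i. conf i \<and> u i = q i}"
  have fB: "finite (th p ` B)"
    by (rule finite_imageI, rule finite_subset[of _ "{1..n}"]) (use conf_index in \<open>auto simp: B_def\<close>)
  \<comment> \<open>The largest threshold at which \<open>q\<close> was taken; if there is none, 0
    lies below all thresholds.\<close>
  define \<tau> where "\<tau> = (if B = {} then 0 else Max (th p ` B))"
  have mem: "\<tau> \<in> th p ` B" if "B \<noteq> {}"
    unfolding \<tau>_def using that Max_in[OF fB] by auto
  have t: "0 \<le> \<tau> \<and> \<tau> < 1"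
  proof (cases "B = {}")
    case False
    then obtain k where "conf k" "\<tau> = th p k" using mem by (auto simp: B_def)
    then show ?thesis using conf_thr[of k] by simp
  qed (simp add: \<tau>_def)
  have "u i = M \<tau> i" for i
  proof (cases "conf i")
    case True
    show ?thesis
    proof (cases "u i = q i")
      case q: True
      then have "i \<in> B" using True by (simp add: B_def)
      then have "th p i \<le> \<tau>" unfolding \<tau>_def using fB by auto
      then show ?thesis using True q by (simp add: mix_def)
    next
      case False
      then have pi: "u i = p i" using cf[OF True] by simp
      have "\<tau> < th p i"
      proof (cases "B = {}")
        case True
        then show ?thesis using conf_thr[OF \<open>conf i\<close>] by (simp add: \<tau>_def)
      next
        case False
        then obtain k where "conf k" "u k = q k" "\<tau> = th p k" using mem by (auto simp: B_def)
        then show ?thesis using Ecal_exchange[OF u True pi] by simp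
      qed
      then show ?thesis using True pi by (simp add: mix_def)
    qed
  next
    case False
    then show ?thesis using nc by (simp add: mix_def)
  qed
  then show ?thesis using that[of \<tau>] t by blast
qed

text \<open>The breakpoints are 0, 1 and the thresholds of the conflicts. The vertex named by
  \<open>y j\<close> has the slope cone from \<open>y j\<close> to \<open>y (Suc j)\<close>, so its
  coefficient is that gap.\<close>

lemma Ecal_enumeration:
  obtains m y where "threshold_enum p q m y" "\<forall>\<tau>\<in>{0..1}. \<exists>j\<le>m. M \<tau> = M (y j)"
    "\<And>g. (\<Sum>u\<in>Ecal n \<alpha> p q. ereal (cone_measure (Ccone n \<alpha> p q u)) * g u)
      = (\<Sum>j\<in>{0..m}. ereal (y (j + 1) - y j) * g (M (y j)))"
proof -
  let ?T = "th p ` {i. conf i}"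
  have "finite ?T"
    by (rule finite_imageI, rule finite_subset[of _ "{1..n}"]) (use conf_index in auto)
  then have "finite ({0, 1} \<union> ?T)" "{0, 1} \<union> ?T \<subseteq> {0..1}"
    using conf_thr by (auto simp: less_imp_le)
  then obtain m y where y: "{0, 1} \<union> ?T = y ` {..Suc m}" "y 0 = 0" "y (Suc m) = 1"
    and lt: "\<And>i j. i < j \<Longrightarrow> j \<le> Suc m \<Longrightarrow> y i < y j"
    and gap: "\<And>s j. j \<le> m \<Longrightarrow> s \<in> {0, 1} \<union> ?T \<Longrightarrow> s \<le> y j \<or> y (Suc j) \<le> s"
    by (rule sorted_enumeration) auto
  have le: "y i \<le> y j" if "i \<le> j" "j \<le> Suc m" for i j
    using lt[of i j] that by (cases "i = j") auto
  have img: "th p i \<in> y ` {1..m}" if "conf i" for i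
  proof -
    have "th p i \<in> y ` {..Suc m}" using that y(1) by blast
    then obtain j where j: "j \<le> Suc m" "th p i = y j" by auto
    moreover have "j \<noteq> 0" "j \<noteq> Suc m" using conf_thr[OF that] j y(2,3) by (metis less_irrefl)+
    ultimately show ?thesis by auto
  qed
  have T: "y j \<in> ?T" if "1 \<le> j" "j \<le> m" for j
  proof -
    have "y j \<in> {0, 1} \<union> ?T" unfolding y(1) using that by auto
    moreover have "0 < y j" "y j < 1" using lt[of 0 j] lt[of j "Suc m"] that y by auto
    ultimately show ?thesis by auto
  qed
  have gap': "th p i \<le> y j \<or> y (Suc j) \<le> th p i" if "conf i" "j \<le> m" for i j
    using gap[of j "th p i"] that by auto
  have cone: "Ccone n \<alpha> p q (M (y j)) = slope_cone (y j) (y (Suc j))" if "j \<le> m" for j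
  proof (rule Ccone_mix)
    show "y (j) < th p i \<longleftrightarrow> y (Suc j) \<le> th p i" if "conf i" for i
      using gap'[OF that \<open>j \<le> m\<close>] lt[of j "Suc j"] \<open>j \<le> m\<close> by auto
    show "y j = 0 \<or> y j \<in> ?T" using T[of j] y(2) that by (cases "j = 0") auto
    show "y (Suc j) = 1 \<or> y (Suc j) \<in> ?T" using T[of "Suc j"] y(3) that by (cases "j = m") auto
  qed simp
  have b: "0 \<le> y j" "y j < y (Suc j)" "y (Suc j) \<le> 1" if "j \<le> m" for j
    using le[of 0 j] lt[of j "Suc j"] le[of "Suc j" "Suc m"] y that by auto
  have every: "\<exists>j\<le>m. M \<tau> = M (y j)" if \<tau>: "0 \<le> \<tau>" "\<tau> \<le> 1" for \<tau>
  proof -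
    define j where "j = (GREATEST j. j \<le> m \<and> y j \<le> \<tau>)"
    have j: "j \<le> m \<and> y j \<le> \<tau>"
      unfolding j_def by (rule GreatestI_nat[of _ 0 m]) (use \<tau> y in auto)
    have "\<not> (Suc j \<le> m \<and> y (Suc j) \<le> \<tau>)"
      using Greatest_le_nat[of "\<lambda>j. j \<le> m \<and> y j \<le> \<tau>" "Suc j" m] unfolding j_def by auto
    then have "\<tau> < th p i" if "y (Suc j) \<le> th p i" "conf i" for i
    proof (cases "j = m")
      case True
      then show ?thesis using that y(3) conf_thr[of i] by auto
    qed (use j that in auto)
    then have "\<tau> < th p i \<longleftrightarrow> y j < th p i" if "conf i" for i
      using gap'[OF that, of j] that j by force
    then have "M \<tau> = M (y j)" by (auto simp: mix_def fun_eq_iff)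
    then show ?thesis using j by blast
  qed
  have E: "Ecal n \<alpha> p q = (\<lambda>j. M (y j)) ` {0..m}"
  proof
    show "Ecal n \<alpha> p q \<subseteq> (\<lambda>j. M (y j)) ` {0..m}"
    proof
      fix u assume "u \<in> Ecal n \<alpha> p q"
      then obtain \<tau> where "0 \<le> \<tau>" "\<tau> < 1" "u = M \<tau>" by (rule Ecal_imp_mix)
      then show "u \<in> (\<lambda>j. M (y j)) ` {0..m}" using every[of \<tau>] by auto
    qed
    show "(\<lambda>j. M (y j)) ` {0..m} \<subseteq> Ecal n \<alpha> p q"
      using mix_Ecal[OF cone] b by auto
  qed
  \<comment> \<open>A positive index \<open>j\<close> names the threshold of some conflict, and that
    coordinate switches from \<open>p\<close> to \<open>q\<close> exactly there.\<close>
  have ne: "M (y i) \<noteq> M (y j)" if "i < j" "j \<le> m" for i j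
  proof
    assume eq: "M (y i) = M (y j)"
    have "y j \<in> ?T" using that by (intro T) auto
    then obtain k where k: "conf k" "y j = th p k" by blast
    have "M (y i) k = p k" "M (y j) k = q k" "p k \<noteq> q k"
      using k lt[OF that(1)] that by (auto simp: mix_def s2_conflict_def)
    then show False using eq by simp
  qed
  have inj: "inj_on (\<lambda>j. M (y j)) {0..m}"
  proof (rule inj_onI)
    fix i j assume "i \<in> {0..m}" "j \<in> {0..m}" "M (y i) = M (y j)"
    then show "i = j" using ne[of i j] ne[of j i] by (cases i j rule: linorder_cases) auto
  qed
  have sum: "(\<Sum>u\<in>Ecal n \<alpha> p q. ereal (cone_measure (Ccone n \<alpha> p q u)) * g u)
      = (\<Sum>j\<in>{0..m}. ereal (y (j + 1) - y j) * g (M (y j)))" for g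
    unfolding E sum.reindex[OF inj] o_def
    using cone b by (intro sum.cong) (auto simp: cone_measure_slope_cone less_imp_le)
  have "threshold_enum p q m y"
    unfolding threshold_enum_def using y(2,3) lt img gap' by blast
  moreover have "\<forall>\<tau>\<in>{0..1}. \<exists>j\<le>m. M \<tau> = M (y j)" using every by simp
  ultimately show ?thesis by (rule that[OF _ _ sum])
qed

end

section \<open>Local submodularity\<close>

lemma sum_ae: "(\<Sum>k\<in>{0..n}. ae (k + 1) - ae k) = 1"
  using sum_Suc_diff[of 0 n ae] by simp

text \<open>The integral of a step function that jumps at \<open>c\<close>: no interval straddles
  \<open>c\<close>, so each term is an increment of \<open>min c y * A + max c y * B\<close> and the
  sum telescopes.\<close>

lemma sum_increments_below:
  fixes y :: "nat \<Rightarrow> real"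
  assumes "\<And>k. k \<le> m \<Longrightarrow> y k < c \<Longrightarrow> y (Suc k) \<le> c" "\<And>k. k \<le> m \<Longrightarrow> y k \<le> y (Suc k)"
    and "y 0 \<le> c" "c \<le> y (Suc m)"
  shows "(\<Sum>k\<in>{0..m}. (y (k + 1) - y k) * (if y k < c then A else B))
    = (c - y 0) * A + (y (Suc m) - c) * B"
proof -
  have "(y (k + 1) - y k) * (if y k < c then A else B) =
      (min c (y (Suc k)) * A + max c (y (Suc k)) * B) - (min c (y k) * A + max c (y k) * B)"
    if "k \<in> {0..m}" for k
    using assms(1)[of k] assms(2)[of k] that by (auto simp: min_def max_def algebra_simps)
  then have "(\<Sum>k\<in>{0..m}. (y (k + 1) - y k) * (if y k < c then A else B)) =
    (\<Sum>k\<in>{0..m}. (min c (y (Suc k)) * A + max c (y (Suc k)) * B) - (min c (y k) * A + max c (y k) * B))"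
    by (intro sum.cong) auto
  also have "\<dots> = (min c (y (Suc m)) * A + max c (y (Suc m)) * B) - (min c (y 0) * A + max c (y 0) * B)"
    by (subst sum_Suc_diff) auto
  finally show ?thesis using assms(3,4) by (simp add: algebra_simps)
qed

text \<open>The domain clauses stand on their own because \<open>real_of_ereal\<close> sends
  \<infinity> to 0, so the real inequalities carry the intended meaning only inside the
  domain.\<close>

definition locally_submodular :: "((nat \<Rightarrow> s2) \<Rightarrow> ereal) \<Rightarrow> bool" where
  "locally_submodular f \<longleftrightarrow> (\<forall>p\<in>fdom f. \<forall>q\<in>fdom f.
     vmeet p q \<in> fdom f \<and>
     (\<forall>\<tau>\<in>{0..1}. mix \<alpha> \<tau> p q \<in> fdom f) \<and>
     ((\<forall>i. \<not> s2_conflict (p i) (q i)) \<longrightarrow>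
        real_of_ereal (f (vmeet p q)) + real_of_ereal (f (vjoin p q))
          \<le> real_of_ereal (f p) + real_of_ereal (f q)) \<and>
     (\<forall>c. (\<forall>i. p i \<noteq> q i \<longrightarrow> s2_conflict (p i) (q i) \<and> th p i = c) \<longrightarrow>
        real_of_ereal (f (vmeet p q))
          \<le> (1 - c) * real_of_ereal (f p) + c * real_of_ereal (f q)))"

context
  fixes f :: "(nat \<Rightarrow> s2) \<Rightarrow> ereal"
  assumes f: "\<And>p. p \<in> S2n n \<Longrightarrow> f p \<noteq> -\<infinity>"
begin

abbreviation "F p \<equiv> real_of_ereal (f p)"

lemma alpha_bisubmodular_iff:
  "alpha_bisubmodular n \<alpha> f \<longleftrightarrow> (\<forall>p\<in>fdom f. \<forall>q\<in>fdom f.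
     vmeet p q \<in> fdom f \<and> (\<forall>k\<in>{0..n}. ae k < ae (k + 1) \<longrightarrow> vjoin_i k p q \<in> fdom f) \<and>
     F (vmeet p q) + (\<Sum>k\<in>{0..n}. (ae (k + 1) - ae k) * F (vjoin_i k p q)) \<le> F p + F q)"
proof -
  have *: "f (vmeet p q) + (\<Sum>k\<in>{0..n}. ereal (ae (k + 1) - ae k) * f (vjoin_i k p q)) \<le> f p + f q
     \<longleftrightarrow> vmeet p q \<in> fdom f \<and> (\<forall>k\<in>{0..n}. ae k < ae (k + 1) \<longrightarrow> vjoin_i k p q \<in> fdom f) \<and>
     F (vmeet p q) + (\<Sum>k\<in>{0..n}. (ae (k + 1) - ae k) * F (vjoin_i k p q)) \<le> F p + F q"
    if "p \<in> fdom f" "q \<in> fdom f" for p q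
  proof -
    have fin: "\<bar>f p + f q\<bar> \<noteq> \<infinity>" "F p + F q = real_of_ereal (f p + f q)"
      using that f[of p] f[of q] by (cases "f p"; cases "f q"; auto)+
    show ?thesis unfolding fin(2)
      by (subst ereal_sum_le_iff) (use that f ae_Suc fin in \<open>auto simp: vmeet_S2n vjoin_i_S2n\<close>)
  qed
  moreover have "f p + f q = \<infinity>" if "p \<in> S2n n" "q \<in> S2n n" "\<not> (p \<in> fdom f \<and> q \<in> fdom f)" for p q
    using that f by auto
  ultimately show ?thesis
    unfolding alpha_bisubmodular_def by (smt (verit) ereal_less_eq(1) mem_Collect_eq)
qed

section \<open>From bisubmodularity to local submodularity\<close>

context
  assumes bisub: "alpha_bisubmodular n \<alpha> f"
begin

lemma bisub_meet: "p \<in> fdom f \<Longrightarrow> q \<in> fdom f \<Longrightarrow> vmeet p q \<in> fdom f"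
  using bisub unfolding alpha_bisubmodular_iff by blast

lemma bisub_ineq:
  assumes "p \<in> fdom f" "q \<in> fdom f"
  shows "F (vmeet p q) + (\<Sum>k\<in>{0..n}. (ae (k + 1) - ae k) * F (vjoin_i k p q)) \<le> F p + F q"
  using bisub assms unfolding alpha_bisubmodular_iff by blast

lemma bisub_join_i:
  "p \<in> fdom f \<Longrightarrow> q \<in> fdom f \<Longrightarrow> k \<le> n \<Longrightarrow> ae k < ae (Suc k) \<Longrightarrow> vjoin_i k p q \<in> fdom f"
  using bisub unfolding alpha_bisubmodular_iff by auto

lemma vjoin_i_eq_vjoin:
  assumes "p \<in> S2n n" "\<And>i. i \<in> {1..n} \<Longrightarrow> i \<le> k \<Longrightarrow> \<not> s2_conflict (p i) (q i)"
  shows "vjoin_i k p q = vjoin p q"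
proof
  fix i
  have "s2_conflict (p i) (q i) \<Longrightarrow> \<not> i \<le> k"
    using assms s2_conflict_index[of p n i "q i"] by blast
  then show "vjoin_i k p q i = vjoin p q i"
    by (cases "p i"; cases "q i") (simp_all add: vjoin_i_def vjoin_def s2_tables)
qed

text \<open>As \<alpha> is positive, the cut at level 0 lies below every coordinate, so the plain
  join occurs with a positive coefficient.\<close>

lemma bisub_join:
  assumes "p \<in> fdom f" "q \<in> fdom f"
  shows "vjoin p q \<in> fdom f"
proof -
  obtain k where k: "k \<le> n" "ae k < ae (Suc k)" "\<And>i. i \<in> {1..n} \<Longrightarrow> i \<le> k \<longleftrightarrow> \<alpha> i \<le> 0"
    by (rule ae_cut_le[of 0]) auto
  have "\<not> i \<le> k" if "i \<in> {1..n}" for i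
    using k(3)[OF that] alpha_pos[OF that] by simp
  then have "vjoin_i k p q = vjoin p q"
    using assms by (intro vjoin_i_eq_vjoin) auto
  then show ?thesis using bisub_join_i[OF assms k(1,2)] by simp
qed

text \<open>The mixture is assembled from meets, plain joins and a single \<open>vjoin_i\<close>,
  whose cut is the condition on the threshold at \<tau> solved for
  \<open>\<alpha> i\<close>.\<close>

lemma bisub_mix:
  assumes p: "p \<in> fdom f" and q: "q \<in> fdom f" and \<tau>: "\<tau> \<in> {0..1}"
  shows "mix \<alpha> \<tau> p q \<in> fdom f"
proof -
  have pS: "p \<in> S2n n" using p by simp
  \<comment> \<open>At conflicts \<open>x\<close> carries \<open>p\<close> and \<open>y\<close>
    carries \<open>q\<close>; elsewhere both carry the join.\<close>
  define x y where "x = vjoin p (vjoin p q)" and "y = vjoin q (vjoin p q)"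
  have x: "x \<in> fdom f" and y: "y \<in> fdom f"
    using bisub_join p q by (auto simp: x_def y_def simp del: mem_Collect_eq)
  consider "1/2 \<le> \<tau>" "\<tau> < 1" | "\<tau> < 1/2" | "\<tau> = 1" using \<tau> by fastforce
  then show ?thesis
  proof cases
    case 1
    then have "0 < 1/\<tau> - 1" "1/\<tau> - 1 \<le> 1" by (auto simp: field_simps)
    then obtain k where k: "k \<le> n" "ae k < ae (Suc k)"
      "\<And>i. i \<in> {1..n} \<Longrightarrow> i \<le> k \<longleftrightarrow> \<alpha> i < 1/\<tau> - 1"
      using ae_cut_less by blast
    define w where "w = vmeet (vjoin_i k p q) x"
    have w: "w \<in> fdom f" unfolding w_def by (intro bisub_meet bisub_join_i p q x k)
    \<comment> \<open>At conflicts \<open>w\<close> is \<open>Pos\<close> where \<open>p\<close> has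
      \<open>Pos\<close> below the cut, and \<open>Zer\<close> otherwise. The double join overwrites
      \<open>y\<close> by \<open>w\<close>: a clash is erased by the inner join and refilled by the
      outer one.\<close>
    have "mix \<alpha> \<tau> p q = vjoin w (vjoin y w)"
    proof
      fix i
      have "\<tau> < th p i \<longleftrightarrow> p i = Pos \<and> i \<le> k" if "s2_conflict (p i) (q i)"
      proof -
        have I: "i \<in> {1..n}" using s2_conflict_index[OF pS that] .
        show ?thesis
          using thr_bounds(4)[OF I, of "p i"] less_thr(1)[of "\<alpha> i" \<tau>] alpha_pos[OF I] k(3)[OF I] 1
          by (cases "p i = Pos") auto
      qed
      then show "mix \<alpha> \<tau> p q i = vjoin w (vjoin y w) i"
        by (cases "p i"; cases "q i")
          (simp_all add: mix_def vjoin_def w_def y_def x_def vmeet_def vjoin_i_def s2_tables)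
    qed
    then show ?thesis using bisub_join[OF w bisub_join[OF y w]] by simp
  next
    case 2
    then have "0 \<le> \<tau>/(1-\<tau>)" "\<tau>/(1-\<tau>) < 1" using \<tau> by (auto simp: field_simps)
    then obtain k where k: "k \<le> n" "ae k < ae (Suc k)"
      "\<And>i. i \<in> {1..n} \<Longrightarrow> i \<le> k \<longleftrightarrow> \<alpha> i \<le> \<tau>/(1-\<tau>)"
      using ae_cut_le by blast
    \<comment> \<open>Below 1/2 the roles are exchanged: only a \<open>Pos\<close> of
      \<open>q\<close> below the cut replaces the value of \<open>p\<close>.\<close>
    define w where "w = vmeet (vjoin_i k p q) y"
    have w: "w \<in> fdom f" unfolding w_def by (intro bisub_meet bisub_join_i p q y k)
    have "mix \<alpha> \<tau> p q = vjoin w (vjoin x w)"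
    proof
      fix i
      have "\<tau> < th p i \<longleftrightarrow> p i = Pos \<or> \<not> i \<le> k" if "s2_conflict (p i) (q i)"
      proof -
        have I: "i \<in> {1..n}" using s2_conflict_index[OF pS that] .
        show ?thesis
          using thr_bounds(3)[OF I, of "p i"] less_thr(2)[of "\<alpha> i" \<tau>] alpha_pos[OF I] k(3)[OF I] 2
          by (cases "p i = Pos") auto
      qed
      then show "mix \<alpha> \<tau> p q i = vjoin w (vjoin x w) i"
        by (cases "p i"; cases "q i")
          (simp_all add: mix_def vjoin_def w_def y_def x_def vmeet_def vjoin_i_def s2_tables)
    qed
    then show ?thesis using bisub_join[OF w bisub_join[OF x w]] by simp
  next
    case 3
    have "mix \<alpha> \<tau> p q = y"
    proof
      fix i
      have "s2_conflict (p i) (q i) \<Longrightarrow> \<not> \<tau> < th p i"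
        using s2_conflict_index[OF pS] thr_bounds(2)[of i "p i"] 3 by auto
      then show "mix \<alpha> \<tau> p q i = y i"
        by (cases "p i"; cases "q i") (simp_all add: mix_def vjoin_def y_def s2_tables)
    qed
    then show ?thesis using y by simp
  qed
qed

lemma bisub_bounded:
  assumes p: "p \<in> fdom f" and q: "q \<in> fdom f" and c: "\<And>i. \<not> s2_conflict (p i) (q i)"
  shows "F (vmeet p q) + F (vjoin p q) \<le> F p + F q"
proof -
  have "vjoin_i k p q = vjoin p q" for k
    using p c by (intro vjoin_i_eq_vjoin) auto
  then have "F (vmeet p q) + (\<Sum>k\<in>{0..n}. (ae (k + 1) - ae k) * F (vjoin p q)) \<le> F p + F q"
    using bisub_ineq[OF p q] by simp
  then show ?thesis unfolding sum_distrib_right[symmetric] sum_ae by simp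
qed

text \<open>With one common \<alpha> at the conflicts, \<open>vjoin_i k p q\<close> has
  \<open>Zer\<close> there until \<open>ae k\<close> reaches it and \<open>Pos\<close> afterwards,
  which splits the total coefficient into \<open>\<alpha> i0\<close> and
  \<open>1 - \<alpha> i0\<close>. For \<open>\<alpha> i0 = 1\<close> the second part vanishes and
  \<open>z\<close> is free, which admits mixed signs.\<close>

lemma bisub_antipodal:
  assumes p: "p \<in> fdom f" and q: "q \<in> fdom f" and i0: "i0 \<in> {1..n}"
    and z: "\<And>i. p i \<noteq> q i \<Longrightarrow> s2_conflict (p i) (q i) \<and> \<alpha> i = \<alpha> i0"
    and zp: "\<alpha> i0 < 1 \<Longrightarrow> z = (\<lambda>i. if p i \<noteq> q i then Pos else p i)"
  shows "(1 + \<alpha> i0) * F (vmeet p q) + (1 - \<alpha> i0) * F z \<le> F p + F q"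
proof -
  have i0': "\<alpha> i0 = ae i0" using i0 by simp
  have "(ae (k + 1) - ae k) * F (vjoin_i k p q)
      = (ae (k + 1) - ae k) * (if ae k < \<alpha> i0 then F (vmeet p q) else F z)"
    if "k \<in> {0..n}" for k
  proof (cases "ae k < ae (Suc k)")
    case True
    have k: "i \<le> k \<longleftrightarrow> \<alpha> i0 \<le> ae k" if "p i \<noteq> q i" for i
    proof -
      have "i \<in> {1..n}" using z[OF that] p s2_conflict_index[of p n i "q i"] by simp
      then show ?thesis using ae_le_iff(1)[of k i] True \<open>k \<in> {0..n}\<close> z[OF that] by simp
    qed
    have "vjoin_i k p q = (if ae k < \<alpha> i0 then vmeet p q else z)"
    proof (cases "ae k < \<alpha> i0")
      case True
      have "vjoin_i k p q i = vmeet p q i" for i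
        using k[of i] z[of i] True
        by (cases "p i"; cases "q i") (simp_all add: vjoin_i_def vmeet_def s2_tables)
      then show ?thesis using True by auto
    next
      case False
      then have "\<alpha> i0 < 1" using True ae_bounds[of "Suc k"] that by auto
      have "vjoin_i k p q i = z i" for i
        using k[of i] z[of i] False zp[OF \<open>\<alpha> i0 < 1\<close>]
        by (cases "p i"; cases "q i") (simp_all add: vjoin_i_def vmeet_def s2_tables)
      then show ?thesis using False by auto
    qed
    then show ?thesis by simp
  next
    case False
    then have "ae (k + 1) - ae k = 0" using ae_Suc[OF that] by simp
    then show ?thesis by (simp only: mult_zero_left)
  qed
  then have "(\<Sum>k\<in>{0..n}. (ae (k + 1) - ae k) * F (vjoin_i k p q))
      = (\<Sum>k\<in>{0..n}. (ae (k + 1) - ae k) * (if ae k < \<alpha> i0 then F (vmeet p q) else F z))"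
    by (intro sum.cong) auto
  also have "\<dots> = (\<alpha> i0 - ae 0) * F (vmeet p q) + (ae (Suc n) - \<alpha> i0) * F z"
  proof (rule sum_increments_below)
    show "ae (Suc k) \<le> \<alpha> i0" if "k \<le> n" "ae k < \<alpha> i0" for k
      using ae_mono[of i0 k] ae_mono[of "Suc k" i0] that i0 i0' by (cases "i0 \<le> k") auto
  qed (use ae_Suc ae_bounds[of i0] i0 in \<open>auto simp: i0' ae_mono simp del: ae_simps\<close>)
  finally have "(\<Sum>k\<in>{0..n}. (ae (k + 1) - ae k) * F (vjoin_i k p q))
      = \<alpha> i0 * F (vmeet p q) + (1 - \<alpha> i0) * F z" by simp
  then show ?thesis
    using bisub_ineq[OF p q] by (simp add: algebra_simps)
qed

text \<open>A common threshold other than 1/2 forces one sign of \<open>p\<close>, hence one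
  \<alpha>, at all differences; the threshold 1/2 forces \<alpha> = 1, where the signs may be
  mixed.\<close>

lemma bisub_thr:
  assumes p: "p \<in> fdom f" and q: "q \<in> fdom f"
    and z: "\<And>i. p i \<noteq> q i \<Longrightarrow> s2_conflict (p i) (q i) \<and> th p i = c"
  shows "F (vmeet p q) \<le> (1 - c) * F p + c * F q"
proof (cases "p = q")
  case True
  then have "vmeet p q = p" by (auto simp: vmeet_def s2_defs)
  then show ?thesis using True by (simp add: algebra_simps)
next
  case False
  then obtain i0 where i0: "p i0 \<noteq> q i0" by auto
  have I: "i \<in> {1..n}" if "p i \<noteq> q i" for i
    using z[OF that] p s2_conflict_index[of p n i "q i"] by simp
  note I0 = I[OF i0]
  note b = alpha_pos[OF I0] alpha_le_1[OF I0]
  consider "1/2 < c" | "c < 1/2" | "c = 1/2" by linarith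
  then show ?thesis
  proof cases
    case 1
    have P: "p i = Pos \<and> \<alpha> i = 1/c - 1" if "p i \<noteq> q i" for i
      using thr_bounds(4)[OF I[OF that], of "p i"] z[OF that] 1 thr_eq(1)[OF alpha_pos[OF I[OF that]]]
      by (cases "p i = Pos") auto
    have "(1 + \<alpha> i0) * F (vmeet p q) + (1 - \<alpha> i0) * F p \<le> F p + F q"
      using P z P[OF i0] by (intro bisub_antipodal[OF p q I0]) (auto simp: fun_eq_iff)
    then have *: "(1 + \<alpha> i0) * F (vmeet p q) \<le> \<alpha> i0 * F p + F q" by (simp add: algebra_simps)
    have "1 + \<alpha> i0 = 1 / c" using P[OF i0] by simp
    then have c: "c = 1 / (1 + \<alpha> i0)" by simp
    have "F (vmeet p q) \<le> (\<alpha> i0 * F p + F q) / (1 + \<alpha> i0)"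
      using * b by (simp add: field_simps)
    also have "\<dots> = (1 - c) * F p + c * F q"
    proof -
      have "1 - c = \<alpha> i0 / (1 + \<alpha> i0)" unfolding c using b by (simp add: field_simps)
      then show ?thesis unfolding c by (simp add: add_divide_distrib)
    qed
    finally show ?thesis .
  next
    case 2
    have c1: "0 < c" using thr_bounds(1)[OF I0, of "p i0"] z[OF i0] by simp
    have P: "q i = Pos \<and> \<alpha> i = c/(1-c)" if "p i \<noteq> q i" for i
    proof -
      have "p i \<noteq> Pos" using thr_bounds(3)[OF I[OF that], of "p i"] z[OF that] 2 by auto
      then have "q i = Pos" using z[OF that] by (cases "p i"; cases "q i") (auto simp: s2_defs)
      then show ?thesis
        using thr_eq(2)[OF alpha_pos[OF I[OF that]] \<open>p i \<noteq> Pos\<close>] z[OF that] by blast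
    qed
    have "(1 + \<alpha> i0) * F (vmeet p q) + (1 - \<alpha> i0) * F q \<le> F p + F q"
      using P z P[OF i0] by (intro bisub_antipodal[OF p q I0]) (auto simp: fun_eq_iff)
    then have *: "(1 + \<alpha> i0) * F (vmeet p q) \<le> F p + \<alpha> i0 * F q" by (simp add: algebra_simps)
    have "1 + \<alpha> i0 = 1 / (1 - c)" using P[OF i0] 2 by (simp add: field_simps)
    then have c: "c = \<alpha> i0 / (1 + \<alpha> i0)" using P[OF i0] 2 by simp
    have "F (vmeet p q) \<le> (F p + \<alpha> i0 * F q) / (1 + \<alpha> i0)"
      using * b by (simp add: field_simps)
    also have "\<dots> = (1 - c) * F p + c * F q"
    proof -
      have "1 - c = 1 / (1 + \<alpha> i0)" unfolding c using b by (simp add: field_simps)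
      then show ?thesis unfolding c by (simp add: add_divide_distrib)
    qed
    finally show ?thesis .
  next
    case 3
    have P: "\<alpha> i = 1" if "p i \<noteq> q i" for i
      using z[OF that] 3 thr_eq(1)[OF alpha_pos[OF I[OF that]], of "1/2"]
        thr_eq(2)[OF alpha_pos[OF I[OF that]], of "p i" "1/2"]
      by (cases "p i = Pos") auto
    have "(1 + \<alpha> i0) * F (vmeet p q) + (1 - \<alpha> i0) * F p \<le> F p + F q"
      using P z P[OF i0] by (intro bisub_antipodal[OF p q I0]) (auto simp: fun_eq_iff)
    then show ?thesis using P[OF i0] unfolding 3 by (simp add: field_simps)
  qed
qed

lemma bisub_locally_submodular: "locally_submodular f"
  unfolding locally_submodular_def
  by (intro ballI conjI allI impI) (erule (1) bisub_meet bisub_mix bisub_bounded bisub_thr; blast)+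

end

section \<open>Chains of mixtures under local submodularity\<close>

context
  assumes loc: "locally_submodular f"
begin

lemma local_meet: "p \<in> fdom f \<Longrightarrow> q \<in> fdom f \<Longrightarrow> vmeet p q \<in> fdom f"
  using loc unfolding locally_submodular_def by blast

lemma local_mix:
  assumes "p \<in> fdom f" "q \<in> fdom f" "0 \<le> \<tau>" "\<tau> \<le> 1"
  shows "mix \<alpha> \<tau> p q \<in> fdom f"
  using loc assms unfolding locally_submodular_def by (meson atLeastAtMost_iff)

lemma local_bounded:
  "p \<in> fdom f \<Longrightarrow> q \<in> fdom f \<Longrightarrow> (\<And>i. \<not> s2_conflict (p i) (q i)) \<Longrightarrow>
    F (vmeet p q) + F (vjoin p q) \<le> F p + F q"
  using loc unfolding locally_submodular_def by blast

lemma local_thr: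
  "p \<in> fdom f \<Longrightarrow> q \<in> fdom f \<Longrightarrow>
    (\<And>i. p i \<noteq> q i \<Longrightarrow> s2_conflict (p i) (q i) \<and> th p i = c) \<Longrightarrow>
    F (vmeet p q) \<le> (1 - c) * F p + c * F q"
  using loc unfolding locally_submodular_def by blast

lemma conflict_thr_bounds:
  assumes "p \<in> S2n n"
  shows "s2_conflict (p i) (q i) \<longrightarrow> 0 < th p i \<and> th p i < 1"
  using thr_bounds(1,2)[of i] s2_conflict_index[OF assms] by blast

context
  fixes p q
  assumes p: "p \<in> fdom f" and q: "q \<in> fdom f"
begin

abbreviation "U \<tau> \<equiv> mix \<alpha> \<tau> p q"
abbreviation "X \<tau> \<equiv> F (vmeet (U 0) (U \<tau>))"
abbreviation "Y \<tau> \<equiv> F (vmeet (U 1) (U \<tau>))"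

lemma U_dom: "0 \<le> \<tau> \<Longrightarrow> \<tau> \<le> 1 \<Longrightarrow> U \<tau> \<in> fdom f"
  using local_mix[OF p q] .

lemma conflict_bounds: "s2_conflict (p i) (q i) \<longrightarrow> 0 < th p i \<and> th p i < 1"
  using conflict_thr_bounds p by simp

text \<open>Local submodularity gives closure under meets and mixtures only; this identity brings
  the plain join into the domain.\<close>

lemma meet_ends: "vmeet (U 0) (U 1) = vjoin p q"
proof
  fix i show "vmeet (U 0) (U 1) i = vjoin p q i"
    using conflict_bounds[of i] by (cases "p i"; cases "q i") (auto simp: mix_def vmeet_def vjoin_def s2_tables)
qed

lemma local_join: "vjoin p q \<in> fdom f"
  using local_meet[OF U_dom[of 0] U_dom[of 1]] meet_ends by simp

text \<open>Reduces the pair p, q to the end mixtures, which differ only at conflicts. With r the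
  plain join, the sum of three bounded inequalities gives it: for p and r, for q and r, and for the
  two resulting meets.\<close>

lemma ends_le: "F (U 0) + F (U 1) + F (vmeet p q) \<le> F p + F q + F (vjoin p q)"
proof -
  let ?r = "vjoin p q"
  note simps = mix_def vmeet_def vjoin_def s2_tables
  have "vjoin p ?r i = U 0 i" for i
    using conflict_bounds[of i] by (cases "p i"; cases "q i") (auto simp: simps)
  moreover have "F (vmeet p ?r) + F (vjoin p ?r) \<le> F p + F ?r"
  proof (rule local_bounded[OF p local_join])
    show "\<not> s2_conflict (p i) (?r i)" for i by (cases "p i"; cases "q i") (auto simp: simps)
  qed
  ultimately have 1: "F (vmeet p ?r) + F (U 0) \<le> F p + F ?r" by (simp add: ext[of "vjoin p ?r" "U 0"])
  have "vjoin q ?r i = U 1 i" for i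
    using conflict_bounds[of i] by (cases "p i"; cases "q i") (auto simp: simps)
  moreover have "F (vmeet q ?r) + F (vjoin q ?r) \<le> F q + F ?r"
  proof (rule local_bounded[OF q local_join])
    show "\<not> s2_conflict (q i) (?r i)" for i by (cases "p i"; cases "q i") (auto simp: simps)
  qed
  ultimately have 2: "F (vmeet q ?r) + F (U 1) \<le> F q + F ?r" by (simp add: ext[of "vjoin q ?r" "U 1"])
  have "vmeet (vmeet p ?r) (vmeet q ?r) i = vmeet p q i \<and> vjoin (vmeet p ?r) (vmeet q ?r) i = ?r i" for i
    by (cases "p i"; cases "q i") (auto simp: simps)
  then have "vmeet (vmeet p ?r) (vmeet q ?r) = vmeet p q" "vjoin (vmeet p ?r) (vmeet q ?r) = ?r"
    by auto
  moreover have "F (vmeet (vmeet p ?r) (vmeet q ?r)) + F (vjoin (vmeet p ?r) (vmeet q ?r))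
      \<le> F (vmeet p ?r) + F (vmeet q ?r)"
  proof (rule local_bounded)
    show "\<not> s2_conflict (vmeet p ?r i) (vmeet q ?r i)" for i
      by (cases "p i"; cases "q i") (auto simp: simps)
  qed (use local_meet local_join p q in blast)+
  ultimately have 3: "F (vmeet p q) + F ?r \<le> F (vmeet p ?r) + F (vmeet q ?r)" by simp
  from 1 2 3 show ?thesis by linarith
qed

context
  fixes \<tau> \<tau>' :: real
  assumes \<tau>: "0 \<le> \<tau>" "\<tau> \<le> \<tau>'" "\<tau>' \<le> 1"
begin

text \<open>Both meets lie below \<open>U \<tau>\<close>, so the pair is bounded. At conflicts the
  values of \<open>p\<close> in \<open>U \<tau>\<close> survive in the meet with \<open>U 0\<close>
  and those of \<open>q\<close> in the meet with \<open>U \<tau>'\<close>, so the join is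
  \<open>U \<tau>\<close>.\<close>

lemma step_X: "F (U \<tau>) + X \<tau>' \<le> X \<tau> + F (vmeet (U \<tau>) (U \<tau>'))"
proof -
  let ?a = "vmeet (U 0) (U \<tau>)" and ?b = "vmeet (U \<tau>) (U \<tau>')"
  have *: "\<not> s2_conflict (?a i) (?b i) \<and> vmeet ?a ?b i = vmeet (U 0) (U \<tau>') i \<and> vjoin ?a ?b i = U \<tau> i" for i
    using conflict_bounds[of i] \<tau> by (cases "p i"; cases "q i") (auto simp: mix_def vmeet_def vjoin_def s2_tables)
  then have "vmeet ?a ?b = vmeet (U 0) (U \<tau>')" "vjoin ?a ?b = U \<tau>" by auto
  moreover have "F (vmeet ?a ?b) + F (vjoin ?a ?b) \<le> F ?a + F ?b"
    using * \<tau> by (intro local_bounded local_meet U_dom) auto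
  ultimately show ?thesis by simp
qed

lemma step_Y: "F (U \<tau>') + Y \<tau> \<le> Y \<tau>' + F (vmeet (U \<tau>) (U \<tau>'))"
proof -
  let ?a = "vmeet (U 1) (U \<tau>')" and ?b = "vmeet (U \<tau>) (U \<tau>')"
  have *: "\<not> s2_conflict (?a i) (?b i) \<and> vmeet ?a ?b i = vmeet (U 1) (U \<tau>) i \<and> vjoin ?a ?b i = U \<tau>' i" for i
    using conflict_bounds[of i] \<tau> by (cases "p i"; cases "q i") (auto simp: mix_def vmeet_def vjoin_def s2_tables)
  then have "vmeet ?a ?b = vmeet (U 1) (U \<tau>)" "vjoin ?a ?b = U \<tau>'" by auto
  moreover have "F (vmeet ?a ?b) + F (vjoin ?a ?b) \<le> F ?a + F ?b"
    using * \<tau> by (intro local_bounded local_meet U_dom) auto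
  ultimately show ?thesis by simp
qed

context
  assumes gap: "\<And>i. s2_conflict (p i) (q i) \<Longrightarrow> th p i \<le> \<tau> \<or> \<tau>' \<le> th p i"
begin

text \<open>With no threshold strictly between, the two mixtures differ only at conflicts with
  threshold exactly \<tau>'.\<close>

lemma step_meet: "F (vmeet (U \<tau>) (U \<tau>')) \<le> (1 - \<tau>') * F (U \<tau>) + \<tau>' * F (U \<tau>')"
proof (rule local_thr[OF U_dom U_dom])
  fix i assume "U \<tau> i \<noteq> U \<tau>' i"
  then show "s2_conflict (U \<tau> i) (U \<tau>' i) \<and> th (U \<tau>) i = \<tau>'"
    using gap[of i] \<tau> by (cases "p i"; cases "q i") (auto simp: mix_def s2_tables split: if_splits)
qed (use \<tau> in auto)

text \<open>Weighting \<open>step_X\<close> and \<open>step_Y\<close> as in \<open>step_meet\<close>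
  eliminates the mixtures and their meet, leaving a relation between \<open>X\<close> and
  \<open>Y\<close> alone.\<close>

lemma step_sum: "0 \<le> (1 - \<tau>') * (X \<tau> - X \<tau>') + \<tau>' * (Y \<tau>' - Y \<tau>)"
proof -
  let ?M = "F (vmeet (U \<tau>) (U \<tau>'))"
  have "(1 - \<tau>') * (F (U \<tau>) - ?M) \<le> (1 - \<tau>') * (X \<tau> - X \<tau>')"
    using step_X \<tau> by (intro mult_left_mono) auto
  moreover have "\<tau>' * (F (U \<tau>') - ?M) \<le> \<tau>' * (Y \<tau>' - Y \<tau>)"
    using step_Y \<tau> by (intro mult_left_mono) auto
  ultimately show ?thesis using step_meet by (simp add: algebra_simps)
qed

lemma step_diff: "\<tau>' * (F (U \<tau>) - F (U \<tau>')) \<le> X \<tau> - X \<tau>'"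
  using step_meet step_X by (simp add: algebra_simps)

end

end

section \<open>From local submodularity to bisubmodularity\<close>

lemma ae_gap:
  assumes "i \<in> {1..n}" "k \<le> n"
  shows "\<alpha> i \<le> ae k \<or> ae (Suc k) \<le> \<alpha> i"
  using ae_mono[of i k] ae_mono[of "Suc k" i] assms by (cases "i \<le> k") force+

text \<open>\<open>step_sum\<close> between neighbouring candidates for a \<open>Pos\<close>
  threshold, which decrease in \<open>k\<close>, scaled by \<open>1 + ae k\<close> to clear
  denominators. Thresholds of \<open>Neg\<close> are at most 1/2 and do not fall inside.\<close>

lemma step_pos:
  assumes k: "k \<le> n"
  shows "0 \<le> ae k * (X (1 / (1 + ae (Suc k))) - X (1 / (1 + ae k)))
    + (Y (1 / (1 + ae k)) - Y (1 / (1 + ae (Suc k))))"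
proof -
  let ?t = "1 / (1 + ae (Suc k))" and ?t' = "1 / (1 + ae k)"
  have a: "0 \<le> ae k" "ae k \<le> ae (Suc k)" "ae (Suc k) \<le> 1"
    using ae_bounds[of k] ae_bounds[of "Suc k"] ae_mono[of k "Suc k"] k by auto
  have "0 \<le> (1 - ?t') * (X ?t - X ?t') + ?t' * (Y ?t' - Y ?t)"
  proof (rule step_sum)
    fix i assume "s2_conflict (p i) (q i)"
    then have i: "i \<in> {1..n}" using s2_conflict_index[of p n i "q i"] p by simp
    show "th p i \<le> ?t \<or> ?t' \<le> th p i"
    proof (cases "p i = Pos")
      case True
      then show ?thesis using ae_gap[OF i k] a alpha_pos[OF i]
        by (auto simp: thr_def intro!: divide_left_mono)
    next
      case False
      have "1/2 \<le> ?t" using a by (simp add: field_simps)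
      then show ?thesis using thr_bounds(4)[OF i False] by linarith
    qed
  qed (use a in \<open>auto simp: frac_le\<close>)
  then have "0 \<le> (1 + ae k) * ((1 - ?t') * (X ?t - X ?t') + ?t' * (Y ?t' - Y ?t))"
    using a by simp
  also have "\<dots> = ((1 + ae k) * (1 - ?t')) * (X ?t - X ?t') + ((1 + ae k) * ?t') * (Y ?t' - Y ?t)"
    by (simp only: distrib_left mult.assoc)
  also have "(1 + ae k) * (1 - ?t') = ae k" using a by (simp add: field_simps)
  also have "(1 + ae k) * ?t' = 1" using a by simp
  finally show ?thesis by simp
qed

lemma step_neg:
  assumes k: "k \<le> n"
  shows "0 \<le> (X (ae k / (1 + ae k)) - X (ae (Suc k) / (1 + ae (Suc k))))
    + ae (Suc k) * (Y (ae (Suc k) / (1 + ae (Suc k))) - Y (ae k / (1 + ae k)))"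
proof -
  let ?t = "ae k / (1 + ae k)" and ?t' = "ae (Suc k) / (1 + ae (Suc k))"
  have a: "0 \<le> ae k" "ae k \<le> ae (Suc k)" "ae (Suc k) \<le> 1"
    using ae_bounds[of k] ae_bounds[of "Suc k"] ae_mono[of k "Suc k"] k by auto
  have mono: "x / (1 + x) \<le> y / (1 + y)" if "0 \<le> x" "x \<le> y" for x y :: real
    using that by (simp add: field_simps)
  have "0 \<le> (1 - ?t') * (X ?t - X ?t') + ?t' * (Y ?t' - Y ?t)"
  proof (rule step_sum)
    fix i assume "s2_conflict (p i) (q i)"
    then have i: "i \<in> {1..n}" using s2_conflict_index[of p n i "q i"] p by simp
    show "th p i \<le> ?t \<or> ?t' \<le> th p i"
    proof (cases "p i = Pos")
      case False
      then show ?thesis using ae_gap[OF i k] a alpha_pos[OF i] mono[of "\<alpha> i" "ae k"] mono[of "ae (Suc k)" "\<alpha> i"]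
        by (auto simp: thr_def)
    next
      case True
      have "?t' \<le> 1/2" using a by (simp add: field_simps)
      then show ?thesis using thr_bounds(3)[OF i True] by linarith
    qed
  qed (use a mono[of "ae k" "ae (Suc k)"] in auto)
  then have "0 \<le> (1 + ae (Suc k)) * ((1 - ?t') * (X ?t - X ?t') + ?t' * (Y ?t' - Y ?t))"
    using a by simp
  also have "\<dots> = ((1 + ae (Suc k)) * (1 - ?t')) * (X ?t - X ?t') + ((1 + ae (Suc k)) * ?t') * (Y ?t' - Y ?t)"
    by (simp only: distrib_left mult.assoc)
  also have "(1 + ae (Suc k)) * (1 - ?t') = 1" using a by (simp add: field_simps)
  also have "(1 + ae (Suc k)) * ?t' = ae (Suc k)" using a by simp
  finally show ?thesis by simp
qed

lemma local_join_i:
  assumes k: "k \<le> n" and lt: "ae k < ae (Suc k)"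
  shows "vjoin_i k p q \<in> fdom f"
    and "F (vjoin p q) + F (vjoin_i k p q) \<le> X (1 / (1 + ae (Suc k))) + Y (ae k / (1 + ae k))"
proof -
  \<comment> \<open>For a positive increment both cuts mean \<open>i \<le> k\<close>: at \<tau> =
    \<open>t\<close> a \<open>Pos\<close> of \<open>p\<close> is still kept, at \<tau> =
    \<open>s\<close> a \<open>Neg\<close> of \<open>p\<close> has already yielded to the
    \<open>Pos\<close> of \<open>q\<close>. Hence \<open>u\<close> and \<open>v\<close> collect the
    \<open>Pos\<close> entries that \<open>vjoin_i k p q\<close> has at conflicts.\<close>
  define t s where t: "t = 1 / (1 + ae (Suc k))" and s: "s = ae k / (1 + ae k)"
  have a: "0 \<le> ae k" "ae (Suc k) \<le> 1"
    using ae_bounds[of k] ae_bounds[of "Suc k"] k by auto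
  have ts: "0 \<le> t" "t \<le> 1" "0 \<le> s" "s \<le> 1" "1/2 \<le> t" "s < 1/2"
    using a lt by (auto simp: t s field_simps)
  define u where "u = vmeet (U 0) (U t)"
  define v where "v = vmeet (U 1) (U s)"
  have uv: "u \<in> fdom f" "v \<in> fdom f"
    unfolding u_def v_def by (intro local_meet U_dom ts; simp)+
  have "\<not> s2_conflict (u i) (v i) \<and> vmeet u v i = vjoin p q i \<and> vjoin u v i = vjoin_i k p q i" for i
  proof (cases "s2_conflict (p i) (q i)")
    case True
    then have i: "i \<in> {1..n}" using s2_conflict_index[of p n i "q i"] p by simp
    note b = thr_bounds(3,4)[OF i, of "p i"] alpha_pos[OF i] conflict_bounds[of i]
    have 1: "t < thr (\<alpha> i) Pos \<longleftrightarrow> i \<le> k"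
      using ae_le_iff(2)[OF lt k i] a lt alpha_pos[OF i] by (simp add: t s thr_def field_simps)
    have 2: "s < thr (\<alpha> i) Neg \<longleftrightarrow> \<not> i \<le> k"
      using ae_le_iff(1)[OF lt k i] a lt alpha_pos[OF i] by (simp add: t s thr_def field_simps) argo
    show ?thesis
      using True 1 2 b ts
      by (cases "p i"; cases "q i")
        (simp_all add: u_def v_def mix_def vmeet_def vjoin_def vjoin_i_def s2_tables)
  next
    case False
    then show ?thesis
      by (cases "p i"; cases "q i")
        (simp_all add: u_def v_def mix_def vmeet_def vjoin_def vjoin_i_def s2_tables)
  qed
  then have *: "\<And>i. \<not> s2_conflict (u i) (v i)" "vmeet u v = vjoin p q" "vjoin u v = vjoin_i k p q"
    by auto
  show "F (vjoin p q) + F (vjoin_i k p q) \<le> X t + Y s"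
    using local_bounded[OF uv *(1)] unfolding *(2,3) unfolding u_def v_def t s .
  have "vmeet (mix \<alpha> 0 u v) (mix \<alpha> 1 u v) = vjoin u v"
    using *(1) by (auto simp: mix_def vmeet_def vjoin_def s2_tables)
  then show "vjoin_i k p q \<in> fdom f"
    using local_meet[OF local_mix[OF uv, of 0] local_mix[OF uv, of 1]] *(3) by simp
qed

text \<open>The candidates for \<open>Pos\<close> run from 1 down to 1/2, those for
  \<open>Neg\<close> from 0 up to 1/2, as \<open>ae (Suc n) = 1\<close>. The boundary terms at 1/2
  have opposite signs and cancel, which leaves the two end mixtures for
  \<open>ends_le\<close>.\<close>

lemma local_bisub_ineq:
  "F (vmeet p q) + (\<Sum>k\<in>{0..n}. (ae (k + 1) - ae k) * F (vjoin_i k p q)) \<le> F p + F q"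
proof -
  define XP YP XN YN where "XP k = X (1 / (1 + ae k))" and "YP k = Y (1 / (1 + ae k))"
    and "XN k = X (ae k / (1 + ae k))" and "YN k = Y (ae k / (1 + ae k))" for k
  have "0 \<le> (\<Sum>k\<in>{0..n}. ae k * (XP (Suc k) - XP k) + (YP k - YP (Suc k)))"
    unfolding XP_def YP_def by (intro sum_nonneg step_pos) simp
  also have "\<dots> = XP (Suc n) - (\<Sum>k\<in>{0..n}. (ae (Suc k) - ae k) * XP (Suc k)) - (YP (Suc n) - YP 0)"
    unfolding sum.distrib sum_by_parts using sum_Suc_diff[of 0 n YP]
    by (simp add: sum_subtractf)
  finally have P: "(\<Sum>k\<in>{0..n}. (ae (Suc k) - ae k) * XP (Suc k)) \<le> XP (Suc n) - YP (Suc n) + F (U 1)"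
    by (simp add: YP_def)
  have "0 \<le> (\<Sum>k\<in>{0..n}. (XN k - XN (Suc k)) + ae (Suc k) * (YN (Suc k) - YN k))"
    unfolding XN_def YN_def by (intro sum_nonneg step_neg) simp
  also have "\<dots> = YN (Suc n) - (\<Sum>k\<in>{0..n}. (ae (Suc k) - ae k) * YN k) - (XN (Suc n) - XN 0)"
    unfolding sum.distrib sum_by_parts' using sum_Suc_diff[of 0 n XN]
    by (simp add: sum_subtractf)
  finally have N: "(\<Sum>k\<in>{0..n}. (ae (Suc k) - ae k) * YN k) \<le> YN (Suc n) - XN (Suc n) + F (U 0)"
    by (simp add: XN_def)
  have "(ae (k + 1) - ae k) * (F (vjoin p q) + F (vjoin_i k p q))
      \<le> (ae (k + 1) - ae k) * (XP (Suc k) + YN k)" if k: "k \<in> {0..n}" for k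
  proof (cases "ae k < ae (Suc k)")
    case True
    then show ?thesis using local_join_i(2)[of k] k
      unfolding XP_def YN_def by (intro mult_left_mono) auto
  next
    case False
    then have "ae (k + 1) - ae k = 0" using ae_Suc[OF k] by simp
    then show ?thesis by (simp only: mult_zero_left)
  qed
  then have "(\<Sum>k\<in>{0..n}. (ae (k + 1) - ae k) * (F (vjoin p q) + F (vjoin_i k p q)))
      \<le> (\<Sum>k\<in>{0..n}. (ae (k + 1) - ae k) * (XP (Suc k) + YN k))"
    by (rule sum_mono)
  then have "F (vjoin p q) + (\<Sum>k\<in>{0..n}. (ae (k + 1) - ae k) * F (vjoin_i k p q))
      \<le> (\<Sum>k\<in>{0..n}. (ae (Suc k) - ae k) * XP (Suc k)) + (\<Sum>k\<in>{0..n}. (ae (Suc k) - ae k) * YN k)"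
    unfolding distrib_left sum.distrib sum_distrib_right[symmetric] sum_ae by simp
  moreover have "XP (Suc n) = XN (Suc n)" "YP (Suc n) = YN (Suc n)"
    by (simp_all add: XP_def XN_def YP_def YN_def)
  ultimately show ?thesis using P N ends_le by linarith
qed

end

lemma locally_submodular_imp_bisub: "alpha_bisubmodular n \<alpha> f"
  unfolding alpha_bisubmodular_iff
proof (intro ballI)
  fix p q assume "p \<in> fdom f" "q \<in> fdom f"
  then show "vmeet p q \<in> fdom f \<and> (\<forall>k\<in>{0..n}. ae k < ae (k + 1) \<longrightarrow> vjoin_i k p q \<in> fdom f) \<and>
     F (vmeet p q) + (\<Sum>k\<in>{0..n}. (ae (k + 1) - ae k) * F (vjoin_i k p q)) \<le> F p + F q"
    using local_meet local_join_i(1) local_bisub_ineq by auto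
qed

text \<open>Summing \<open>step_diff\<close> over the gaps telescopes \<open>X\<close> from the
  first mixture to the plain join; summation by parts turns the other side into the weighted
  sum.\<close>

lemma local_submodular_ineq:
  assumes p: "p \<in> fdom f" and q: "q \<in> fdom f"
    and enum: "threshold_enum p q m y"
  shows "F (vmeet p q) + (\<Sum>j\<in>{0..m}. (y (j + 1) - y j) * F (mix \<alpha> (y j) p q)) \<le> F p + F q"
proof -
  note y = threshold_enumD(1,2)[OF enum] and mono = threshold_enumD(4)[OF enum]
    and gap = threshold_enumD(6)[OF enum]
  define u X where "u j = F (mix \<alpha> (y j) p q)"
    and "X j = F (vmeet (mix \<alpha> 0 p q) (mix \<alpha> (y j) p q))" for j
  have "(\<Sum>j\<in>{0..m}. - (y (Suc j) * (u (Suc j) - u j))) \<le> (\<Sum>j\<in>{0..m}. - (X (Suc j) - X j))"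
  proof (rule sum_mono)
    fix j assume j: "j \<in> {0..m}"
    have "y (Suc j) * (u j - u (Suc j)) \<le> X j - X (Suc j)"
      unfolding u_def X_def
    proof (rule step_diff[OF p q])
      show "0 \<le> y j" "y j \<le> y (Suc j)" "y (Suc j) \<le> 1"
        using mono[of 0 j] mono[of j "Suc j"] mono[of "Suc j" "Suc m"] y j by auto
      show "th p i \<le> y j \<or> y (Suc j) \<le> th p i" if "s2_conflict (p i) (q i)" for i
        using gap[OF that] j by simp
    qed
    then show "- (y (Suc j) * (u (Suc j) - u j)) \<le> - (X (Suc j) - X j)"
      by (simp add: algebra_simps)
  qed
  also have "\<dots> = X 0 - X (Suc m)"
    unfolding sum_negf using sum_Suc_diff[of 0 m X] by simp
  finally have "(\<Sum>j\<in>{0..m}. (y (Suc j) - y j) * u j) - u (Suc m) \<le> X 0 - X (Suc m)"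
    unfolding sum_negf sum_by_parts' using y by simp
  moreover have "X 0 = F (mix \<alpha> 0 p q)" "X (Suc m) = F (vjoin p q)" "u (Suc m) = F (mix \<alpha> 1 p q)"
    using meet_ends[OF p q] y by (simp_all add: X_def u_def)
  ultimately show ?thesis using ends_le[OF p q] by (simp add: u_def)
qed

end

section \<open>Local submodularity and the valuation\<close>

text \<open>All coefficients are positive, so the inequality forces every vertex into the domain,
  and with the vertices every mixture.\<close>

lemma valuation_ineq_enumeration:
  assumes p: "p \<in> fdom f" and q: "q \<in> fdom f"
  obtains m y where "threshold_enum p q m y"
    "\<forall>\<tau>\<in>{0..1}. \<exists>j\<le>m. mix \<alpha> \<tau> p q = mix \<alpha> (y j) p q"
    "f (vmeet p q) + (\<Sum>u\<in>Ecal n \<alpha> p q. ereal (cone_measure (Ccone n \<alpha> p q u)) * f u) \<le> f p + f q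
      \<longleftrightarrow> vmeet p q \<in> fdom f \<and> (\<forall>j\<le>m. mix \<alpha> (y j) p q \<in> fdom f) \<and>
        F (vmeet p q) + (\<Sum>j\<in>{0..m}. (y (j + 1) - y j) * F (mix \<alpha> (y j) p q)) \<le> F p + F q"
proof -
  have S: "p \<in> S2n n" "q \<in> S2n n" using p q by auto
  obtain m y where enum: "threshold_enum p q m y"
    and all: "\<forall>\<tau>\<in>{0..1}. \<exists>j\<le>m. mix \<alpha> \<tau> p q = mix \<alpha> (y j) p q"
    and sum: "\<And>g. (\<Sum>u\<in>Ecal n \<alpha> p q. ereal (cone_measure (Ccone n \<alpha> p q u)) * g u)
      = (\<Sum>j\<in>{0..m}. ereal (y (j + 1) - y j) * g (mix \<alpha> (y j) p q))"
    by (rule Ecal_enumeration[OF S]) blast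
  have pos: "0 < y (j + 1) - y j" if "j \<in> {0..m}" for j
    using threshold_enumD(3)[OF enum, of j "j + 1"] that by simp
  have fin: "\<bar>f p + f q\<bar> \<noteq> \<infinity>" "F p + F q = real_of_ereal (f p + f q)"
    using p q f[of p] f[of q] by (cases "f p"; cases "f q"; auto)+
  have "f (vmeet p q) + (\<Sum>j\<in>{0..m}. ereal (y (j + 1) - y j) * f (mix \<alpha> (y j) p q)) \<le> f p + f q
      \<longleftrightarrow> f (vmeet p q) \<noteq> \<infinity> \<and>
        (\<forall>j\<in>{0..m}. 0 < y (j + 1) - y j \<longrightarrow> f (mix \<alpha> (y j) p q) \<noteq> \<infinity>) \<and>
        F (vmeet p q) + (\<Sum>j\<in>{0..m}. (y (j + 1) - y j) * F (mix \<alpha> (y j) p q)) \<le> F p + F q"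
    unfolding fin(2)
    by (rule ereal_sum_le_iff)
      (use f[OF vmeet_S2n[OF S]] f[OF mix_S2n[OF S]] fin less_imp_le[OF pos] in auto)
  also have "\<dots> \<longleftrightarrow> vmeet p q \<in> fdom f \<and> (\<forall>j\<le>m. mix \<alpha> (y j) p q \<in> fdom f) \<and>
        F (vmeet p q) + (\<Sum>j\<in>{0..m}. (y (j + 1) - y j) * F (mix \<alpha> (y j) p q)) \<le> F p + F q"
  proof -
    have dom: "vmeet p q \<in> fdom f \<longleftrightarrow> f (vmeet p q) \<noteq> \<infinity>"
      "mix \<alpha> (y j) p q \<in> fdom f \<longleftrightarrow> f (mix \<alpha> (y j) p q) \<noteq> \<infinity>" for j
      using vmeet_S2n[OF S] mix_S2n[OF S] by simp_all
    have "(\<forall>j\<in>{0..m}. 0 < y (j + 1) - y j \<longrightarrow> A j) \<longleftrightarrow> (\<forall>j\<le>m. A j)" for A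
      using pos by (metis atLeastAtMost_iff le0)
    then show ?thesis unfolding dom by (simp only:)
  qed
  finally show ?thesis
    by (intro that[of m y] enum all) (simp only: sum)
qed

lemma submodular_wrt_val_iff:
  "submodular_wrt_val n \<alpha> f \<longleftrightarrow> (\<forall>p\<in>fdom f. \<forall>q\<in>fdom f.
    f (vmeet p q) + (\<Sum>u\<in>Ecal n \<alpha> p q. ereal (cone_measure (Ccone n \<alpha> p q u)) * f u) \<le> f p + f q)"
proof -
  have "f p + f q = \<infinity>" if "p \<in> S2n n" "q \<in> S2n n" "\<not> (p \<in> fdom f \<and> q \<in> fdom f)" for p q
    using that f by auto
  then show ?thesis
    unfolding submodular_wrt_val_def by (smt (verit) ereal_less_eq(1) mem_Collect_eq)
qed

lemma locally_submodular_imp_submodular: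
  assumes "locally_submodular f"
  shows "submodular_wrt_val n \<alpha> f"
  unfolding submodular_wrt_val_iff
proof (intro ballI)
  fix p q assume pq: "p \<in> fdom f" "q \<in> fdom f"
  then obtain m y where enum: "threshold_enum p q m y"
    and all: "\<forall>\<tau>\<in>{0..1}. \<exists>j\<le>m. mix \<alpha> \<tau> p q = mix \<alpha> (y j) p q"
    and iff: "f (vmeet p q) + (\<Sum>u\<in>Ecal n \<alpha> p q. ereal (cone_measure (Ccone n \<alpha> p q u)) * f u) \<le> f p + f q
      \<longleftrightarrow> vmeet p q \<in> fdom f \<and> (\<forall>j\<le>m. mix \<alpha> (y j) p q \<in> fdom f) \<and>
        F (vmeet p q) + (\<Sum>j\<in>{0..m}. (y (j + 1) - y j) * F (mix \<alpha> (y j) p q)) \<le> F p + F q"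
    by (rule valuation_ineq_enumeration)
  note y = threshold_enumD(1,2)[OF enum] and le = threshold_enumD(4)[OF enum]
  have "mix \<alpha> (y j) p q \<in> fdom f" if "j \<le> m" for j
    using local_mix[OF assms pq, of "y j"] le[of 0 j] le[of j "Suc m"] that y by simp
  then show "f (vmeet p q) + (\<Sum>u\<in>Ecal n \<alpha> p q. ereal (cone_measure (Ccone n \<alpha> p q u)) * f u) \<le> f p + f q"
    unfolding iff using local_meet[OF assms pq] local_submodular_ineq[OF assms pq enum] by blast
qed

text \<open>Both local inequalities are instances: without conflicts every mixture is the plain
  join, and with one threshold c the chain is p below c and q from c on.\<close>

lemma submodular_imp_locally_submodular:
  assumes "submodular_wrt_val n \<alpha> f"
  shows "locally_submodular f"
  unfolding locally_submodular_def
proof (intro ballI)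
  fix p q assume pq: "p \<in> fdom f" "q \<in> fdom f"
  then obtain m y where enum: "threshold_enum p q m y"
    and all: "\<forall>\<tau>\<in>{0..1}. \<exists>j\<le>m. mix \<alpha> \<tau> p q = mix \<alpha> (y j) p q"
    and iff: "f (vmeet p q) + (\<Sum>u\<in>Ecal n \<alpha> p q. ereal (cone_measure (Ccone n \<alpha> p q u)) * f u) \<le> f p + f q
      \<longleftrightarrow> vmeet p q \<in> fdom f \<and> (\<forall>j\<le>m. mix \<alpha> (y j) p q \<in> fdom f) \<and>
        F (vmeet p q) + (\<Sum>j\<in>{0..m}. (y (j + 1) - y j) * F (mix \<alpha> (y j) p q)) \<le> F p + F q"
    by (rule valuation_ineq_enumeration)
  have "f (vmeet p q) + (\<Sum>u\<in>Ecal n \<alpha> p q. ereal (cone_measure (Ccone n \<alpha> p q u)) * f u) \<le> f p + f q"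
    using assms pq unfolding submodular_wrt_val_iff by blast
  then have meet: "vmeet p q \<in> fdom f" and mixes: "\<And>j. j \<le> m \<Longrightarrow> mix \<alpha> (y j) p q \<in> fdom f"
    and ineq: "F (vmeet p q) + (\<Sum>j\<in>{0..m}. (y (j + 1) - y j) * F (mix \<alpha> (y j) p q)) \<le> F p + F q"
    unfolding iff by blast+
  note y = threshold_enumD(1,2)[OF enum] and lt = threshold_enumD(3)[OF enum]
    and img = threshold_enumD(5)[OF enum]
  have 1: "\<forall>\<tau>\<in>{0..1}. mix \<alpha> \<tau> p q \<in> fdom f"
    using all mixes by metis
  have 2: "F (vmeet p q) + F (vjoin p q) \<le> F p + F q" if "\<And>i. \<not> s2_conflict (p i) (q i)"
  proof -
    have "mix \<alpha> \<tau> p q = vjoin p q" for \<tau>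
      using that by (simp add: mix_def vjoin_def)
    then have "F (vmeet p q) + (\<Sum>j\<in>{0..m}. y (Suc j) - y j) * F (vjoin p q) \<le> F p + F q"
      using ineq by (simp add: sum_distrib_right)
    then show ?thesis using sum_Suc_diff[of 0 m y] y by simp
  qed
  have 3: "F (vmeet p q) \<le> (1 - c) * F p + c * F q"
    if c: "\<And>i. p i \<noteq> q i \<Longrightarrow> s2_conflict (p i) (q i) \<and> th p i = c" for c
  proof (cases "p = q")
    case False
    then obtain i where "p i \<noteq> q i" by auto
    then have "c \<in> y ` {1..m}" using img[of i] c[of i] by simp
    then obtain k where k: "1 \<le> k" "k \<le> m" "c = y k" by auto
    have "mix \<alpha> (y j) p q i = (if y j < c then p else q) i" for i j
      using c[of i] by (cases "p i = q i") (auto simp: mix_def s2_tables)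
    then have mix: "F (mix \<alpha> (y j) p q) = (if y j < c then F p else F q)" for j
      by (auto simp: fun_eq_iff[of "mix \<alpha> (y j) p q" p] fun_eq_iff[of "mix \<alpha> (y j) p q" q]
          intro!: arg_cong[where f = "\<lambda>p. F p"])
    have "(\<Sum>j\<in>{0..m}. (y (j + 1) - y j) * (if y j < c then F p else F q))
        = (c - y 0) * F p + (y (Suc m) - c) * F q"
    proof (rule sum_increments_below)
      show "y (Suc j) \<le> c" if "j \<le> m" "y j < c" for j
      proof -
        have "j < k" using that lt[of k j] k by (cases j k rule: linorder_cases) auto
        then show ?thesis using lt[of "Suc j" k] k by (cases "Suc j = k") auto
      qed
      show "y j \<le> y (Suc j)" if "j \<le> m" for j using lt[of j "Suc j"] that by simp
      show "y 0 \<le> c" "c \<le> y (Suc m)" using lt[of 0 k] lt[of k "Suc m"] k by auto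
    qed
    then show ?thesis using ineq y by (simp add: mix algebra_simps)
  next
    case True
    then show ?thesis by (simp add: algebra_simps)
  qed
  show "vmeet p q \<in> fdom f \<and> (\<forall>\<tau>\<in>{0..1}. mix \<alpha> \<tau> p q \<in> fdom f) \<and>
    ((\<forall>i. \<not> s2_conflict (p i) (q i)) \<longrightarrow> F (vmeet p q) + F (vjoin p q) \<le> F p + F q) \<and>
    (\<forall>c. (\<forall>i. p i \<noteq> q i \<longrightarrow> s2_conflict (p i) (q i) \<and> th p i = c) \<longrightarrow>
       F (vmeet p q) \<le> (1 - c) * F p + c * F q)"
    using meet 1 2 3 by blast
qed

end

end

theorem theorem3p14:
  fixes n :: nat and \<alpha> :: "nat \<Rightarrow> real" and f :: "(nat \<Rightarrow> s2) \<Rightarrow> ereal"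
  assumes "1 \<le> n \<Longrightarrow> 0 < \<alpha> 1"
    and "\<And>i. 1 \<le> i \<Longrightarrow> i < n \<Longrightarrow> \<alpha> i \<le> \<alpha> (Suc i)"
    and "1 \<le> n \<Longrightarrow> \<alpha> n \<le> 1"
    and "\<And>p. p \<in> S2n n \<Longrightarrow> f p \<noteq> -\<infinity>"
  shows "alpha_bisubmodular n \<alpha> f \<longleftrightarrow> submodular_wrt_val n \<alpha> f"
proof -
  have mono: "\<alpha> i \<le> \<alpha> j" if "1 \<le> i" "i \<le> j" "j \<le> n" for i j
    using that(2,3)
  proof (induction j rule: dec_induct)
    case (step k)
    then show ?case using assms(2)[of k] that(1) by simp
  qed simp
  interpret alpha_weights n \<alpha>
  proof
    show "0 < \<alpha> i" if "i \<in> {1..n}" for i using mono[of 1 i] assms(1) that by simp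
    show "\<alpha> i \<le> 1" if "i \<in> {1..n}" for i using mono[of i n] assms(3) that by simp
    show "\<alpha> i \<le> \<alpha> j" if "i \<in> {1..n}" "j \<in> {1..n}" "i \<le> j" for i j using mono that by simp
  qed
  have "locally_submodular f" if "alpha_bisubmodular n \<alpha> f"
    using assms(4) that by (rule bisub_locally_submodular)
  moreover have "alpha_bisubmodular n \<alpha> f" if "locally_submodular f"
    using assms(4) that by (rule locally_submodular_imp_bisub)
  moreover have "locally_submodular f" if "submodular_wrt_val n \<alpha> f"
    using assms(4) that by (rule submodular_imp_locally_submodular)
  moreover have "submodular_wrt_val n \<alpha> f" if "locally_submodular f"
    using assms(4) that by (rule locally_submodular_imp_submodular)
  ultimately show ?thesis by argo
qed

end
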